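(* Let $0<\alpha<1$. For any integer $m\geq 1$ there exists a one-dimensional curve $s\mapsto (c_s,\varphi_s)$, with $s\in I$, such that $$h(x)=\varphi_s(x)\in C^{1,\alpha}([0,2\pi],\mathbb{R})$$ is an $m$-fold traveling wave solution, with constant speed $c_s$, to the equation $$h_{t}=-\frac{1}{2}\left(3 hh_{x}-[\mathscr{L},\mathscr{N}h]h - \mathscr{N}h-h_{x} \right).$$
   Context: Functions are real-valued and $2\pi$-periodic in the space variable, and $C^{1,\alpha}$ is the usual Hölder space. The parameter set $I$ is an interval of real numbers. The operators $\mathscr{L}=-\partial_x^2(1-\partial_x^2)^{-1}$ and $\mathscr{N}=\partial_x(1-\partial_x^2)^{-1}$ are the Fourier multipliers $$\widehat{\mathscr{L}f}(\xi)=\frac{\xi^2}{1+\xi^2}\hat f(\xi),\qquad \widehat{\mathscr{N}f}(\xi)=\frac{i\xi}{1+\xi^2}\hat f(\xi),$$ and the commutator is $[\mathscr{L},f]g=\mathscr{L}(fg)-f\mathscr{L}g$. A traveling wave solution with constant speed $c$ and profile $\varphi$ is a solution of the form $h(x,t)=\varphi(x-ct)$, i.e. $\varphi$ satisfies $$-c\varphi'=-\frac{1}{2}\left(3 \varphi\varphi'-[\mathscr{L},\mathscr{N}\varphi]\varphi - \mathscr{N}\varphi-\varphi' \right).$$ It is called $m$-fold if $\varphi(\xi+\tfrac{2\pi}{m})=\varphi(\xi)$ for all $\xi$. *)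

theory Defs
  imports "HOL-Analysis.Analysis"
begin

definition two_pi_periodic :: "(real \<Rightarrow> 'a) \<Rightarrow> bool" where
  "two_pi_periodic f \<longleftrightarrow> (\<forall>x. f (x + 2 * pi) = f x)"

definition m_fold :: "nat \<Rightarrow> (real \<Rightarrow> real) \<Rightarrow> bool" where
  "m_fold m f \<longleftrightarrow> (\<forall>x. f (x + 2 * pi / real m) = f x)"

definition fourier_coeff :: "(real \<Rightarrow> real) \<Rightarrow> int \<Rightarrow> complex" where
  "fourier_coeff f k =
     integral {0..2 * pi} (\<lambda>x. complex_of_real (f x) * exp (- (\<i> * of_int k * complex_of_real x)))
       / (2 * pi)"

(* The image of f is described by its Fourier coefficients. A continuous periodic function is
   determined by these, so at most one function qualifies; for the bounded symbols used below and
   Hoelder continuous periodic f one exists. *)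
definition fourier_multiplier :: "(int \<Rightarrow> complex) \<Rightarrow> (real \<Rightarrow> real) \<Rightarrow> real \<Rightarrow> real" where
  "fourier_multiplier \<mu> f =
     (THE g. continuous_on UNIV g \<and> two_pi_periodic g \<and>
             (\<forall>k. fourier_coeff g k = \<mu> k * fourier_coeff f k))"

definition L_op :: "(real \<Rightarrow> real) \<Rightarrow> real \<Rightarrow> real" where
  "L_op = fourier_multiplier (\<lambda>k. (of_int k)\<^sup>2 / (1 + (of_int k)\<^sup>2))"

definition N_op :: "(real \<Rightarrow> real) \<Rightarrow> real \<Rightarrow> real" where
  "N_op = fourier_multiplier (\<lambda>k. \<i> * of_int k / (1 + (of_int k)\<^sup>2))"

definition commutator ::
  "((real \<Rightarrow> real) \<Rightarrow> real \<Rightarrow> real) \<Rightarrow> (real \<Rightarrow> real) \<Rightarrow> (real \<Rightarrow> real) \<Rightarrow> real \<Rightarrow> real" where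
  "commutator T f g = (\<lambda>x. T (\<lambda>y. f y * g y) x - f x * T g x)"

definition equation_rhs :: "(real \<Rightarrow> real) \<Rightarrow> real \<Rightarrow> real" where
  "equation_rhs f x =
     - (1 / 2) * (3 * f x * deriv f x - commutator L_op (N_op f) f x - N_op f x - deriv f x)"

(* h takes the space variable first: h x t *)
definition solves_equation :: "(real \<Rightarrow> real \<Rightarrow> real) \<Rightarrow> bool" where
  "solves_equation h \<longleftrightarrow>
     (\<forall>t. two_pi_periodic (\<lambda>x. h x t)) \<and>
     (\<forall>x t. (\<lambda>y. h y t) differentiable at x \<and>
            (h x has_real_derivative equation_rhs (\<lambda>y. h y t) x) (at t))"

definition traveling_wave_solution :: "real \<Rightarrow> (real \<Rightarrow> real) \<Rightarrow> bool" where
  "traveling_wave_solution c \<phi> \<longleftrightarrow> solves_equation (\<lambda>x t. \<phi> (x - c * t))"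

lemma traveling_wave_solution_profile_equation:
  assumes "traveling_wave_solution c \<phi>"
  shows "- c * deriv \<phi> x =
    - (1 / 2) * (3 * \<phi> x * deriv \<phi> x - commutator L_op (N_op \<phi>) \<phi> x - N_op \<phi> x - deriv \<phi> x)"
proof -
  have *: "(\<lambda>y. \<phi> (y - c * 0)) differentiable at x \<and>
           ((\<lambda>t. \<phi> (x - c * t)) has_real_derivative equation_rhs (\<lambda>y. \<phi> (y - c * 0)) x) (at 0)"
    using assms unfolding traveling_wave_solution_def solves_equation_def by blast
  then have rhs: "((\<lambda>t. \<phi> (x - c * t)) has_real_derivative equation_rhs \<phi> x) (at 0)"
    by simp
  from * have "\<phi> differentiable at x"
    by simp
  then have "(\<phi> has_real_derivative deriv \<phi> x) (at (x - c * 0))"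
    by (simp add: DERIV_deriv_iff_real_differentiable)
  then have "((\<lambda>t. \<phi> (x - c * t)) has_real_derivative deriv \<phi> x * - c) (at 0)"
    by (rule DERIV_chain2) (auto intro!: derivative_eq_intros)
  with rhs have "equation_rhs \<phi> x = deriv \<phi> x * - c"
    by (rule DERIV_unique)
  then show ?thesis
    by (simp add: equation_rhs_def)
qed

(* C^{1,\<alpha>} of the circle, with functions on the circle represented as periodic functions on the
   line. Because of the periodicity, taking the Hoelder condition and the suprema over the whole
   line instead of [0, 2 pi] gives the same space with an equivalent norm. *)
definition C1_holder :: "real \<Rightarrow> (real \<Rightarrow> real) set" where
  "C1_holder \<alpha> =
     {f. two_pi_periodic f \<and> (\<forall>x. f differentiable at x) \<and>
         (\<exists>C. \<forall>x y. \<bar>deriv f x - deriv f y\<bar> \<le> C * \<bar>x - y\<bar> powr \<alpha>)}"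

definition C1_holder_norm :: "real \<Rightarrow> (real \<Rightarrow> real) \<Rightarrow> real" where
  "C1_holder_norm \<alpha> f =
     (SUP x. \<bar>f x\<bar>) + (SUP x. \<bar>deriv f x\<bar>) +
     (SUP (x, y) \<in> {(x, y). x \<noteq> y}. \<bar>deriv f x - deriv f y\<bar> / \<bar>x - y\<bar> powr \<alpha>)"

(* A continuous curve in the product of the real line and C^{1,\<alpha>}. *)
definition continuous_curve ::
  "real \<Rightarrow> real set \<Rightarrow> (real \<Rightarrow> real) \<Rightarrow> (real \<Rightarrow> real \<Rightarrow> real) \<Rightarrow> bool" where
  "continuous_curve \<alpha> I c \<phi> \<longleftrightarrow>
     continuous_on I c \<and>
     (\<forall>s\<in>I. \<phi> s \<in> C1_holder \<alpha>) \<and>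
     (\<forall>s\<in>I. ((\<lambda>t. C1_holder_norm \<alpha> (\<lambda>x. \<phi> t x - \<phi> s x)) \<longlongrightarrow> 0) (at s within I))"

(* Spatial translates of a wave solve the equation with the same speed and do not count as new
   points of a curve of waves. *)
definition same_wave :: "real \<Rightarrow> (real \<Rightarrow> real) \<Rightarrow> real \<Rightarrow> (real \<Rightarrow> real) \<Rightarrow> bool" where
  "same_wave c \<phi> d \<psi> \<longleftrightarrow> c = d \<and> (\<exists>a. \<forall>x. \<phi> x = \<psi> (x + a))"

end

theory Submission
  imports Defs "HOL-Library.Nat_Bijection"
begin

text \<open>The profile equation is a total derivative. Put \<open>A = (1 - \<partial>\<^sup>2)\<^sup>-\<^sup>1\<close>, so that \<open>L = 1 - A\<close> and
  \<open>N = \<partial> A\<close>, and let \<open>u = A \<phi>\<close>. Integrating once with integration constant 0 turns it into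
  \<open>Q \<phi> = A \<phi> + (1 + 2 c) \<phi>\<close> with \<open>Q \<phi> = 3/2 \<phi>\<^sup>2 - u\<^sup>2/2 + A (u\<^sup>2 - u'\<^sup>2)/2\<close>, in which no derivative
  is lost. The linear part \<open>A + 1 + 2 c\<close> has the eigenfunction \<open>cos (m x)\<close> in its kernel when
  \<open>1 + 2 c = - 1 / (1 + m\<^sup>2)\<close>. Writing \<open>\<phi> = s (2 cos (m x) + y)\<close> with \<open>y\<close> even, supported on the frequencies
  that are multiples of \<open>m\<close> and free of the frequencies \<open>\<plusminus>m\<close>, the mode \<open>m\<close> determines \<open>c\<close>, and the
  other modes become a fixed point equation for \<open>y\<close> that is a contraction for small \<open>s\<close> in the algebra of
  sequences of Fourier coefficients with \<open>\<Sum>n. (1 + \<bar>n\<bar>)\<^sup>2 \<bar>a n\<bar> < \<infinity>\<close>. The modulus of the \<open>m\<close>-th Fourier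
  coefficient of the wave is \<open>s\<close>, so different \<open>s\<close> give waves that are not translates of each other.\<close>

no_notation Infinite_Set_Sum.abs_summable_on (infix \<open>abs'_summable'_on\<close> 50)

section \<open>Uniqueness of Fourier coefficients\<close>

lemma cis_add_int_period: "cis (of_int k * (x + 2 * pi)) = cis (of_int k * x)"
proof -
  have "cis (of_int k * (x + 2 * pi)) = cis (of_int k * x) * cis (2 * pi * of_int k)"
    by (simp add: cis_mult algebra_simps)
  then show ?thesis
    by simp
qed

lemma cis_2pi_int [simp]: "cis (of_int k * (2 * pi)) = 1"
  using cis_add_int_period[of k 0] by simp

lemma cis_has_vector_derivative:
  "((\<lambda>x. cis (r * x)) has_vector_derivative \<i> * of_real r * cis (r * x)) (at x within S)"
proof -
  have "((\<lambda>z. exp (\<i> * of_real r * z)) has_field_derivative \<i> * of_real r * exp (\<i> * of_real r * of_real x))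
      (at (of_real x))"
    by (auto intro!: derivative_eq_intros)
  then have "((\<lambda>x. exp (\<i> * of_real r * of_real x)) has_vector_derivative
      \<i> * of_real r * exp (\<i> * of_real r * of_real x)) (at x within S)"
    by (rule has_vector_derivative_real_field)
  then show ?thesis
    by (simp add: cis_conv_exp mult.assoc)
qed

lemma has_integral_cis_int:
  "((\<lambda>x. cis (of_int k * x)) has_integral (if k = 0 then complex_of_real (2 * pi) else 0)) {0..2 * pi}"
proof (cases "k = 0")
  case True
  then show ?thesis
    using has_integral_const_real[of "1::complex" 0 "2 * pi"] by (simp add: scaleR_conv_of_real)
next
  case False
  have "((\<lambda>x. cis (of_int k * x)) has_integral
      cis (of_int k * (2 * pi)) / (\<i> * of_int k) - cis (of_int k * 0) / (\<i> * of_int k)) {0..2 * pi}"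
  proof (rule fundamental_theorem_of_calculus)
    fix x
    show "((\<lambda>x. cis (of_int k * x) / (\<i> * of_int k)) has_vector_derivative cis (of_int k * x))
        (at x within {0..2 * pi})"
      using has_vector_derivative_divide[OF cis_has_vector_derivative[of "of_int k" x "{0..2 * pi}"],
          of "\<i> * of_int k"]
        False by (simp add: field_simps)
  qed simp
  with False show ?thesis
    by simp
qed

lemma fourier_coeff_cis:
  "fourier_coeff f k = integral {0..2 * pi} (\<lambda>x. complex_of_real (f x) * cis (- (of_int k * x))) / (2 * pi)"
  by (simp add: fourier_coeff_def cis_conv_exp mult.assoc)

definition null_fourier :: "(real \<Rightarrow> complex) \<Rightarrow> bool" where
  "null_fourier H \<longleftrightarrow> continuous_on {0..2 * pi} H \<and>
     (\<forall>k::int. integral {0..2 * pi} (\<lambda>x. H x * cis (of_int k * x)) = 0)"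

lemma integrable_mult_cis:
  assumes "continuous_on {0..2 * pi} H"
  shows "(\<lambda>x. H x * cis (of_int k * x)) integrable_on {0..2 * pi}"
  by (intro integrable_continuous_real continuous_intros assms)

lemma null_fourier_add:
  assumes "null_fourier H" "null_fourier K"
  shows "null_fourier (\<lambda>x. H x + K x)"
  using assms by (auto simp: null_fourier_def distrib_right integral_add integrable_mult_cis
      intro!: continuous_intros)

lemma null_fourier_cmult:
  assumes "null_fourier H"
  shows "null_fourier (\<lambda>x. c * H x)"
  using assms by (auto simp: null_fourier_def mult.assoc intro!: continuous_intros)

lemma null_fourier_shift:
  assumes "null_fourier H"
  shows "null_fourier (\<lambda>x. cis (of_int j * x) * H x)"
proof -
  have "integral {0..2 * pi} (\<lambda>x. cis (of_int j * x) * H x * cis (of_int k * x)) =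
      integral {0..2 * pi} (\<lambda>x. H x * cis (of_int (j + k) * x))" for k
    by (rule integral_cong) (simp add: cis_mult distrib_right mult.assoc mult.left_commute[of _ "H _"])
  with assms show ?thesis
    unfolding null_fourier_def by (simp del: of_int_add add: continuous_on_mult continuous_on_cis)
qed

text \<open>On the circle a real linear form is a combination of \<open>cis x\<close> and
  \<open>cis (- x)\<close>, hence acts on \<open>H\<close> by two frequency shifts, which preserve
  vanishing of all coefficients. \<open>H\<close> stays arbitrary in the induction because the
  product case applies one hypothesis to the outcome of the other.\<close>

lemma null_fourier_mult_polynomial:
  fixes p :: "complex \<Rightarrow> real"
  assumes "real_polynomial_function p" and "null_fourier H"
  shows "null_fourier (\<lambda>x. complex_of_real (p (cis x)) * H x)"
  using assms
proof (induction arbitrary: H rule: real_polynomial_function.induct)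
  case (linear f)
  have f: "f z = Re z * f 1 + Im z * f \<i>" for z
  proof -
    have "f (Re z *\<^sub>R 1 + Im z *\<^sub>R \<i>) = Re z * f 1 + Im z * f \<i>"
      using linear(1) by (simp only: bounded_linear.linear linear_add linear_scale real_scaleR_def)
    moreover have "Re z *\<^sub>R 1 + Im z *\<^sub>R \<i> = z"
      by (simp add: complex_eq_iff)
    ultimately show ?thesis
      by simp
  qed
  have "complex_of_real (f (cis x)) * H x =
      ((f 1 - \<i> * f \<i>) / 2) * (cis (of_int 1 * x) * H x) + ((f 1 + \<i> * f \<i>) / 2) * (cis (of_int (-1) * x) * H x)" for x
    by (subst f) (simp add: complex_eq_iff field_simps)
  then show ?case
    by (simp only:) (intro null_fourier_add null_fourier_cmult null_fourier_shift linear)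
next
  case (const c)
  then show ?case
    by (rule null_fourier_cmult)
next
  case (add f g)
  then show ?case
    by (simp add: distrib_right null_fourier_add)
next
  case (mult f g)
  from mult.IH(1)[OF mult.IH(2)[OF mult.prems]] show ?case
    by (simp add: mult.assoc)
qed

text \<open>The argument function jumps at the point 1, so continuity is obtained from closed sets
  instead: the preimage of a closed set under \<open>F\<close> is the image under \<open>cis\<close>
  of a compact part of the parameter interval. The equal end values make \<open>F\<close> correct at
  the right end point.\<close>

lemma periodic_continuous_factors_through_circle:
  fixes h :: "real \<Rightarrow> 'a::topological_space"
  assumes cont: "continuous_on {0..2 * pi} h" and ends: "h (2 * pi) = h 0"
  obtains F where "continuous_on (sphere 0 1) F"
    and "\<And>x. x \<in> {0..2 * pi} \<Longrightarrow> F (cis x) = h x"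
proof
  define F where "F z = h (Arg2pi z)" for z
  have arg: "Arg2pi (cis x) = x" if "0 \<le> x" "x < 2 * pi" for x
    by (rule Arg2pi_unique[of 1]) (use that in \<open>auto simp: cis_conv_exp\<close>)
  show F: "F (cis x) = h x" if "x \<in> {0..2 * pi}" for x
  proof (cases "x = 2 * pi")
    case True
    with arg[of 0] ends show ?thesis
      by (simp add: F_def)
  next
    case False
    with that arg[of x] show ?thesis
      by (simp add: F_def)
  qed
  have "closed (F -` B \<inter> sphere 0 1)" if "closed B" for B
  proof -
    have "F -` B \<inter> sphere 0 1 = cis ` (h -` B \<inter> {0..2 * pi})"
    proof (intro equalityI subsetI)
      fix z assume z: "z \<in> F -` B \<inter> sphere 0 1"
      then have "cis (Arg2pi z) = z"
        using complex_norm_eq_1_exp[of z] by (simp add: cis_conv_exp)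
      moreover have "Arg2pi z \<in> h -` B \<inter> {0..2 * pi}"
        using z Arg2pi[of z] by (auto simp: F_def)
      ultimately show "z \<in> cis ` (h -` B \<inter> {0..2 * pi})"
        by force
    qed (use F in auto)
    moreover have "compact (h -` B \<inter> {0..2 * pi})"
      using cont that by (metis bounded_Int bounded_closed_interval closed_real_atLeastAtMost
          compact_eq_bounded_closed continuous_on_closed_vimage)
    ultimately show ?thesis
      by (simp add: compact_continuous_image compact_imp_closed continuous_on_cis continuous_on_id)
  qed
  then show "continuous_on (sphere 0 1) F"
    by (simp add: continuous_on_closed_vimage)
qed

text \<open>By Stone-Weierstrass, \<open>h\<close> is uniformly close to a polynomial
  \<open>p\<close> on the circle. As \<open>h\<close> is orthogonal to \<open>p\<close>, the
  integral of \<open>h\<close> squared equals that of \<open>(h - p) h\<close> and is arbitrarily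
  small.\<close>

lemma null_fourier_imp_zero:
  fixes h :: "real \<Rightarrow> real"
  assumes null: "null_fourier (\<lambda>x. complex_of_real (h x))"
    and ends: "h (2 * pi) = h 0" and x: "x \<in> {0..2 * pi}"
  shows "h x = 0"
proof -
  have cont: "continuous_on {0..2 * pi} h"
    using null continuous_on_Re[of _ "\<lambda>x. complex_of_real (h x)"] by (simp add: null_fourier_def)
  obtain F where F: "continuous_on (sphere 0 1) F" "\<And>x. x \<in> {0..2 * pi} \<Longrightarrow> F (cis x) = h x"
    using periodic_continuous_factors_through_circle[OF cont ends] by metis
  obtain M where M: "\<And>x. x \<in> {0..2 * pi} \<Longrightarrow> \<bar>h x\<bar> \<le> M"
    using compact_imp_bounded[OF compact_continuous_image[OF cont]] by (force simp: bounded_iff)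
  have small: "integral {0..2 * pi} (\<lambda>x. h x * h x) \<le> e * M * (2 * pi)" if "e > 0" for e
  proof -
    obtain p where p: "real_polynomial_function p" "\<And>z. z \<in> sphere 0 1 \<Longrightarrow> \<bar>F z - p z\<bar> < e"
      using Stone_Weierstrass_real_polynomial_function[OF compact_sphere F(1) \<open>e > 0\<close>] by metis
    have pc: "continuous_on {0..2 * pi} (\<lambda>x. p (cis x))"
      by (rule continuous_on_compose2[of UNIV p])
        (use p(1) in \<open>auto simp: real_polynomial_function_eq
          intro: continuous_on_polymonial_function continuous_on_cis continuous_on_id\<close>)
    have "integral {0..2 * pi} (\<lambda>x. complex_of_real (p (cis x)) * complex_of_real (h x) *
        cis (of_int 0 * x)) = 0"
      using null_fourier_mult_polynomial[OF p(1) null] unfolding null_fourier_def by blast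
    then have "integral {0..2 * pi} (\<lambda>x. complex_of_real (p (cis x) * h x)) = 0"
      by simp
    moreover have "(\<lambda>x. p (cis x) * h x) integrable_on {0..2 * pi}"
      by (intro integrable_continuous_real continuous_intros cont pc)
    ultimately have "complex_of_real (integral {0..2 * pi} (\<lambda>x. p (cis x) * h x)) = 0"
      using integral_linear[OF _ bounded_linear_of_real[where 'a = complex], of "\<lambda>x. p (cis x) * h x" "{0..2 * pi}"]
      by (simp add: comp_def)
    then have "integral {0..2 * pi} (\<lambda>x. p (cis x) * h x) = 0"
      by simp
    moreover have "(\<lambda>x. p (cis x) * h x) integrable_on {0..2 * pi}"
      "(\<lambda>x. h x * h x) integrable_on {0..2 * pi}"
      by (intro integrable_continuous_real continuous_intros cont pc)+
    ultimately have "integral {0..2 * pi} (\<lambda>x. h x * h x) =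
        integral {0..2 * pi} (\<lambda>x. h x * h x - p (cis x) * h x)"
      by (simp add: integral_diff)
    also have "\<dots> \<le> integral {0..2 * pi} (\<lambda>x. e * M)"
    proof (rule integral_le)
      fix x assume x: "x \<in> {0..2 * pi}"
      have "h x * h x - p (cis x) * h x = (F (cis x) - p (cis x)) * h x"
        using F(2)[OF x] by (simp add: algebra_simps)
      also have "\<dots> \<le> \<bar>F (cis x) - p (cis x)\<bar> * \<bar>h x\<bar>"
        by (metis abs_ge_self abs_mult)
      also have "\<dots> \<le> e * M"
        using p(2)[of "cis x"] M[OF x] \<open>e > 0\<close> by (intro mult_mono) auto
      finally show "h x * h x - p (cis x) * h x \<le> e * M" .
    qed (auto intro!: integrable_continuous_real continuous_intros cont pc)
    finally show ?thesis
      by (simp add: mult_ac)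
  qed
  have "integral {0..2 * pi} (\<lambda>x. h x * h x) \<le> 0"
  proof (rule field_le_epsilon)
    fix e :: real assume "e > 0"
    have "M \<ge> 0"
      using M[of 0] by simp
    \<comment> \<open>Dividing by \<open>M + 1\<close> rather than \<open>M\<close> covers the case
      that the bound \<open>M\<close> is 0.\<close>
    then have "e / ((M + 1) * (2 * pi)) > 0"
      using \<open>e > 0\<close> by simp
    from small[OF this] have "integral {0..2 * pi} (\<lambda>x. h x * h x) \<le> e * (M / (M + 1))"
      by simp
    also have "\<dots> \<le> e * 1"
      using \<open>M \<ge> 0\<close> \<open>e > 0\<close> by (intro mult_left_mono) auto
    finally show "integral {0..2 * pi} (\<lambda>x. h x * h x) \<le> 0 + e"
      by simp
  qed
  moreover have "integral {0..2 * pi} (\<lambda>x. h x * h x) \<ge> 0"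
    by (rule integral_nonneg) (auto intro!: integrable_continuous_real continuous_intros cont)
  ultimately have "integral {0..2 * pi} (\<lambda>x. h x * h x) = 0"
    by simp
  moreover have "continuous_on {0..2 * pi} (\<lambda>x. h x * h x)"
    by (intro continuous_on_mult cont)
  ultimately have "\<forall>x\<in>{0..2 * pi}. h x * h x = 0"
    by (subst (asm) integral_eq_0_iff) auto
  with x have "h x * h x = 0"
    by blast
  then show ?thesis
    by simp
qed

lemma two_pi_periodic_int:
  assumes "two_pi_periodic f"
  shows "f (x + of_int k * (2 * pi)) = f x"
proof -
  have nat: "f (x + of_nat n * (2 * pi)) = f x" for n x
  proof (induction n)
    case (Suc n)
    have "f ((x + of_nat n * (2 * pi)) + 2 * pi) = f (x + of_nat n * (2 * pi))"
      using assms by (simp only: two_pi_periodic_def)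
    with Suc show ?case
      by (simp add: algebra_simps)
  qed simp
  show ?thesis
  proof (cases k rule: int_cases2)
    case (nonneg n)
    with nat[of x n] show ?thesis by simp
  next
    case (nonpos n)
    have "f (x - of_nat n * (2 * pi) + of_nat n * (2 * pi)) = f (x - of_nat n * (2 * pi))"
      by (rule nat)
    then have "f (x - of_nat n * (2 * pi)) = f x"
      by (simp only: diff_add_cancel)
    then show ?thesis
      by (simp add: nonpos)
  qed
qed

text \<open>All coefficients of the difference vanish, so it vanishes on one period and, by
  periodicity, everywhere. This is the uniqueness that the definite description in
  \<open>fourier_multiplier\<close> relies on.\<close>

lemma fourier_coeff_inject:
  assumes f: "continuous_on UNIV f" "two_pi_periodic f"
    and g: "continuous_on UNIV g" "two_pi_periodic g"
    and eq: "\<And>k. fourier_coeff f k = fourier_coeff g k"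
  shows "f = g"
proof
  fix x :: real
  define h where "h x = f x - g x" for x
  have c: "continuous_on {0..2 * pi} f" "continuous_on {0..2 * pi} g"
    using f g continuous_on_subset by blast+
  have "null_fourier (\<lambda>x. complex_of_real (h x))"
    unfolding null_fourier_def
  proof (intro conjI allI)
    fix k :: int
    have "integral {0..2 * pi} (\<lambda>x. complex_of_real (f x) * cis (of_int k * x)) =
        integral {0..2 * pi} (\<lambda>x. complex_of_real (g x) * cis (of_int k * x))"
      using eq[of "- k"] by (simp add: fourier_coeff_cis)
    moreover have "(\<lambda>x. complex_of_real (f x) * cis (of_int k * x)) integrable_on {0..2 * pi}"
      "(\<lambda>x. complex_of_real (g x) * cis (of_int k * x)) integrable_on {0..2 * pi}"
      by (intro integrable_mult_cis continuous_intros c)+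
    ultimately show "integral {0..2 * pi} (\<lambda>x. complex_of_real (h x) * cis (of_int k * x)) = 0"
      by (simp add: h_def left_diff_distrib integral_diff)
  qed (auto simp: h_def intro!: continuous_intros c)
  moreover have per: "two_pi_periodic h"
    using f g by (simp add: two_pi_periodic_def h_def)
  then have "h (2 * pi) = h 0"
    by (metis add_0 two_pi_periodic_def)
  ultimately have zero: "h y = 0" if "y \<in> {0..2 * pi}" for y
    using null_fourier_imp_zero that by blast
  define k where "k = \<lfloor>x / (2 * pi)\<rfloor>"
  define y where "y = x - of_int k * (2 * pi)"
  have "of_int k * (2 * pi) \<le> x" "x \<le> (of_int k + 1) * (2 * pi)"
    using floor_divide_lower[of "2 * pi" x] floor_divide_upper[of "2 * pi" x] by (simp_all add: k_def)
  then have "y \<in> {0..2 * pi}"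
    by (simp add: y_def algebra_simps)
  from zero[OF this] have "h (y + of_int k * (2 * pi)) = 0"
    by (simp only: two_pi_periodic_int[OF per])
  then have "h x = 0"
    by (simp add: y_def)
  then show "f x = g x"
    by (simp add: h_def)
qed

section \<open>Absolutely convergent Fourier series\<close>

text \<open>The value type is left open because both real sequences and complex Fourier coefficients
  are convolved.\<close>

definition conv :: "(int \<Rightarrow> 'a) \<Rightarrow> (int \<Rightarrow> 'a) \<Rightarrow> int \<Rightarrow> 'a::{real_normed_field, banach}" where
  "conv a b n = (\<Sum>\<^sub>\<infinity>j. a j * b (n - j))"

text \<open>The double family \<open>a j * b k\<close> is absolutely summable over all pairs.
  Substituting \<open>n = j + k\<close> regroups it along antidiagonals, and Fubini for sums gives
  all three claims.\<close>

lemma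
  fixes a b :: "int \<Rightarrow> 'a::{real_normed_field, banach}"
  assumes a: "a abs_summable_on UNIV" and b: "b abs_summable_on UNIV"
  shows conv_terms_abs_summable: "(\<lambda>j. a j * b (n - j)) abs_summable_on UNIV"
    and conv_abs_summable: "conv a b abs_summable_on UNIV"
    and infsum_conv: "infsum (conv a b) UNIV = infsum a UNIV * infsum b UNIV"
proof -
  have "(\<lambda>(j, k). a j * b k) abs_summable_on UNIV \<times> UNIV"
  proof (rule iffD2[OF Infinite_Sum.abs_summable_on_Sigma_iff], intro conjI ballI)
    show "(\<lambda>j. \<Sum>\<^sub>\<infinity>k. norm (case (j, k) of (j, k) \<Rightarrow> a j * b k)) abs_summable_on UNIV"
      using a by (simp add: norm_mult infsum_cmult_right' abs_mult summable_on_cmult_left)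
  qed (use b in \<open>simp add: norm_mult summable_on_cmult_right\<close>)
  moreover have bij: "bij_betw (\<lambda>(n, j). (j, n - j)) (UNIV \<times> UNIV) (UNIV \<times> (UNIV :: int set))"
    by (rule bij_betwI[where g = "\<lambda>(j, k). (j + k, j)"]) auto
  ultimately have prod: "(\<lambda>(n, j). a j * b (n - j)) abs_summable_on UNIV \<times> UNIV"
    using summable_on_reindex_bij_betw[OF bij, of "\<lambda>(j, k). norm (a j * b k)"]
    by (simp add: case_prod_unfold)
  then show terms: "(\<lambda>j. a j * b (n - j)) abs_summable_on UNIV" for n
    unfolding Infinite_Sum.abs_summable_on_Sigma_iff by simp
  have "(\<lambda>n. \<Sum>\<^sub>\<infinity>j. norm (a j * b (n - j))) abs_summable_on UNIV"
    using prod unfolding Infinite_Sum.abs_summable_on_Sigma_iff by simp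
  moreover have "norm (conv a b n) \<le> norm (\<Sum>\<^sub>\<infinity>j. norm (a j * b (n - j)))" for n
    using norm_infsum_bound[OF terms[of n]] by (simp add: conv_def)
  ultimately show "conv a b abs_summable_on UNIV"
    by (rule Infinite_Sum.abs_summable_on_comparison_test)
  have "infsum (conv a b) UNIV = infsum (\<lambda>(n, j). a j * b (n - j)) (UNIV \<times> UNIV)"
    using infsum_Sigma_banach[OF abs_summable_summable[OF prod]] by (simp add: conv_def[abs_def])
  also have "\<dots> = infsum (\<lambda>(j, k). a j * b k) (UNIV \<times> UNIV)"
    using infsum_reindex_bij_betw[OF bij, of "\<lambda>(j, k). a j * b k"] by (simp add: case_prod_unfold)
  also have "\<dots> = (\<Sum>\<^sub>\<infinity>j. \<Sum>\<^sub>\<infinity>k. a j * b k)"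
    using infsum_Sigma_banach[of "\<lambda>(j, k). a j * b k" UNIV "\<lambda>_. UNIV"]
      abs_summable_summable[OF \<open>(\<lambda>(j, k). a j * b k) abs_summable_on UNIV \<times> UNIV\<close>] by simp
  also have "\<dots> = infsum a UNIV * infsum b UNIV"
    by (simp add: infsum_cmult_right' infsum_cmult_left')
  finally show "infsum (conv a b) UNIV = infsum a UNIV * infsum b UNIV" .
qed

section \<open>Sums of absolutely convergent Fourier series\<close>

definition fseries :: "(int \<Rightarrow> complex) \<Rightarrow> real \<Rightarrow> complex" where
  "fseries a x = (\<Sum>\<^sub>\<infinity>n. a n * cis (of_int n * x))"

lemma abs_summable_mult_cis:
  "(\<lambda>n. a n * cis (t n)) abs_summable_on A \<longleftrightarrow> a abs_summable_on A"
  by (simp add: norm_mult)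

lemma fseries_has_sum:
  assumes "a abs_summable_on UNIV"
  shows "((\<lambda>n. a n * cis (of_int n * x)) has_sum fseries a x) UNIV"
  unfolding fseries_def
  by (rule has_sum_infsum, rule abs_summable_summable) (simp add: abs_summable_mult_cis assms)

lemma norm_fseries_le:
  assumes "a abs_summable_on UNIV"
  shows "norm (fseries a x) \<le> (\<Sum>\<^sub>\<infinity>n. norm (a n))"
  using norm_infsum_le[OF fseries_has_sum[OF assms] has_sum_infsum[OF assms]] by (simp add: norm_mult)

lemma fseries_uniform_limit:
  assumes "a abs_summable_on UNIV"
  shows "uniform_limit S (\<lambda>F x. \<Sum>n\<in>F. a n * cis (of_int n * x)) (fseries a) (finite_subsets_at_top UNIV)"
  unfolding fseries_def
  by (rule Weierstrass_m_test_general[OF _ assms]) (simp add: norm_mult)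

lemma continuous_on_fseries:
  assumes "a abs_summable_on UNIV"
  shows "continuous_on S (fseries a)"
  by (rule uniform_limit_theorem[OF _ fseries_uniform_limit[OF assms]])
    (auto intro!: always_eventually continuous_intros)

text \<open>Uniform convergence lets the limit over finite sets of frequencies pass through the
  integral, and every finite partial sum that contains the frequency 0 already has the integral
  claimed.\<close>

lemma integral_fseries:
  fixes a :: "int \<Rightarrow> complex"
  assumes a: "a abs_summable_on UNIV"
  shows "integral {0..2 * pi} (fseries a) = 2 * pi * a 0"
proof -
  obtain I J where I: "\<And>F. ((\<lambda>x. \<Sum>n\<in>F. a n * cis (of_int n * x)) has_integral I F) {0..2 * pi}"
    and J: "(fseries a has_integral J) {0..2 * pi}"
    and lim: "(I \<longlongrightarrow> J) (finite_subsets_at_top UNIV)"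
  proof (rule uniform_limit_integral[OF fseries_uniform_limit[OF a]])
    show "continuous_on {0..2 * pi} (\<lambda>x. \<Sum>n\<in>F. a n * cis (of_int n * x))" for F
      by (intro continuous_intros)
  qed (use that in auto)
  have "I F = 2 * pi * a 0" if "finite F" "0 \<in> F" for F
  proof -
    have "((\<lambda>x. \<Sum>n\<in>F. a n * cis (of_int n * x)) has_integral
        (\<Sum>n\<in>F. a n * (if n = 0 then complex_of_real (2 * pi) else 0))) {0..2 * pi}"
      by (intro has_integral_sum has_integral_mult_right has_integral_cis_int that)
    also have "(\<Sum>n\<in>F. a n * (if n = 0 then complex_of_real (2 * pi) else 0)) = 2 * pi * a 0"
      using that by (simp add: if_distrib[of "\<lambda>x. _ * x"] sum.delta cong: if_cong)
    finally show ?thesis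
      using I has_integral_unique by blast
  qed
  then have "\<forall>\<^sub>F F in finite_subsets_at_top UNIV. I F = 2 * pi * a 0"
    unfolding eventually_finite_subsets_at_top by (intro exI[of _ "{0}"]) auto
  then have "(I \<longlongrightarrow> 2 * pi * a 0) (finite_subsets_at_top UNIV)"
    by (rule tendsto_eventually)
  with lim have "J = 2 * pi * a 0"
    using tendsto_unique finite_subsets_at_top_neq_bot by blast
  with J show ?thesis
    by (simp add: integral_unique)
qed

text \<open>Moves the frequency \<open>k\<close> to 0, so that \<open>integral_fseries\<close>
  yields every Fourier coefficient.\<close>

lemma fseries_shift_index:
  assumes "a abs_summable_on UNIV"
  shows "fseries a x * cis (- (of_int k * x)) = fseries (\<lambda>n. a (n + k)) x"
proof -
  have "((\<lambda>n. a n * cis (of_int n * x) * cis (- (of_int k * x))) has_sum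
      fseries a x * cis (- (of_int k * x))) UNIV"
    by (intro has_sum_cmult_left fseries_has_sum assms)
  moreover have "bij_betw (\<lambda>n. n + k) UNIV UNIV"
    by (rule bij_betwI[where g = "\<lambda>n. n - k"]) auto
  ultimately have "((\<lambda>n. a (n + k) * cis (of_int (n + k) * x) * cis (- (of_int k * x))) has_sum
      fseries a x * cis (- (of_int k * x))) UNIV"
    using has_sum_reindex_bij_betw by fastforce
  moreover have "cis (of_int (n + k) * x) * cis (- (of_int k * x)) = cis (of_int n * x)" for n
    by (simp add: cis_mult algebra_simps)
  ultimately show ?thesis
    by (simp add: fseries_def mult.assoc infsumI)
qed

text \<open>Characters are multiplicative, so multiplying the coefficients by them commutes with
  convolution; what remains is \<open>infsum_conv\<close> for the modified sequences.\<close>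

lemma fseries_conv:
  assumes "a abs_summable_on UNIV" "b abs_summable_on UNIV"
  shows "fseries (conv a b) x = fseries a x * fseries b x"
proof -
  have "conv a b n * cis (of_int n * x) =
      conv (\<lambda>n. a n * cis (of_int n * x)) (\<lambda>n. b n * cis (of_int n * x)) n" for n
    unfolding conv_def infsum_cmult_left'[symmetric]
  proof (rule infsum_cong)
    fix j
    have "cis (of_int n * x) = cis (of_int j * x) * cis (of_int (n - j) * x)"
      by (simp add: cis_mult algebra_simps)
    then show "a j * b (n - j) * cis (of_int n * x) =
        a j * cis (of_int j * x) * (b (n - j) * cis (of_int (n - j) * x))"
      by (simp only:) (simp add: mult_ac)
  qed
  then show ?thesis
    using assms by (simp add: fseries_def infsum_conv abs_summable_mult_cis)
qed

text \<open>Membership of a real function in the Wiener algebra together with its coefficients. As a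
  relation it can be derived by one rule per operation on functions.\<close>

definition wiener_rep :: "(real \<Rightarrow> real) \<Rightarrow> (int \<Rightarrow> complex) \<Rightarrow> bool" where
  "wiener_rep f a \<longleftrightarrow> a abs_summable_on UNIV \<and> (\<forall>x. complex_of_real (f x) = fseries a x)"

lemma wiener_rep_fourier_coeff:
  assumes "wiener_rep f a"
  shows "fourier_coeff f k = a k"
proof -
  have a: "a abs_summable_on UNIV" and f: "\<And>x. complex_of_real (f x) = fseries a x"
    using assms by (auto simp: wiener_rep_def)
  have "bij_betw (\<lambda>n. n + k) UNIV UNIV"
    by (rule bij_betwI[where g = "\<lambda>n. n - k"]) auto
  then have "(\<lambda>n. a (n + k)) abs_summable_on UNIV"
    using a summable_on_reindex_bij_betw[of "\<lambda>n. n + k" UNIV UNIV "\<lambda>n. norm (a n)"] by simp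
  from integral_fseries[OF this] show ?thesis
    by (simp add: fourier_coeff_cis f fseries_shift_index[OF a])
qed

lemma wiener_rep_continuous:
  assumes "wiener_rep f a"
  shows "continuous_on S f"
proof -
  have "f = (\<lambda>x. Re (fseries a x))"
    using assms by (auto simp: wiener_rep_def) (metis Re_complex_of_real)
  moreover have "continuous_on S (\<lambda>x. Re (fseries a x))"
    using assms by (intro continuous_on_Re continuous_on_fseries) (simp add: wiener_rep_def)
  ultimately show ?thesis
    by simp
qed

text \<open>Each character that occurs is invariant under the shift. This serves both the period
  \<open>2 * pi\<close> and the shorter period of \<open>m\<close>-fold waves.\<close>

lemma wiener_rep_periodic:
  assumes "wiener_rep f a" and "\<And>n. a n \<noteq> 0 \<Longrightarrow> cis (of_int n * t) = 1"
  shows "f (x + t) = f x"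
proof -
  have "a n * cis (of_int n * (x + t)) = a n * cis (of_int n * x)" for n
    using assms(2)[of n] by (cases "a n = 0") (simp_all add: distrib_left flip: cis_mult)
  then have "fseries a (x + t) = fseries a x"
    by (simp only: fseries_def)
  with assms(1) show ?thesis
    unfolding wiener_rep_def by (metis of_real_eq_iff)
qed

lemma wiener_rep_two_pi_periodic:
  assumes "wiener_rep f a"
  shows "two_pi_periodic f"
  unfolding two_pi_periodic_def by (intro allI wiener_rep_periodic[OF assms]) simp

lemma wiener_rep_unique:
  assumes "wiener_rep f a" "wiener_rep g a"
  shows "f = g"
  using assms unfolding wiener_rep_def by (metis ext of_real_eq_iff)

lemma wiener_rep_cong:
  assumes "wiener_rep f a" "\<And>x. f x = g x" "\<And>n. a n = b n"
  shows "wiener_rep g b"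
proof -
  from assms have "f = g" "a = b" by auto
  with assms show ?thesis by simp
qed

lemma wiener_rep_cnj:
  assumes "wiener_rep f a"
  shows "a (- n) = cnj (a n)"
proof -
  have "a n = integral {0..2 * pi} (\<lambda>x. complex_of_real (f x) * cis (- (of_int n * x))) / (2 * pi)"
    using wiener_rep_fourier_coeff[OF assms] by (simp add: fourier_coeff_cis)
  also have "cnj \<dots> = integral {0..2 * pi} (\<lambda>x. complex_of_real (f x) * cis (of_int n * x)) / (2 * pi)"
    using integral_linear[OF integrable_mult_cis bounded_linear_cnj,
        of "\<lambda>x. complex_of_real (f x)" "- n"] wiener_rep_continuous[OF assms]
    by (simp add: cis_cnj comp_def continuous_on_of_real)
  also have "\<dots> = a (- n)"
    using wiener_rep_fourier_coeff[OF assms, of "- n"] by (simp add: fourier_coeff_cis)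
  finally show ?thesis
    by simp
qed

text \<open>Conjugation followed by the reindexing \<open>n\<close> to \<open>- n\<close> maps the
  series to itself, so its sum is real and equals its real part.\<close>

lemma wiener_rep_Re_fseries:
  assumes a: "a abs_summable_on UNIV" and cnj: "\<And>n. a (- n) = cnj (a n)"
  shows "wiener_rep (\<lambda>x. Re (fseries a x)) a"
proof -
  have "cnj (fseries a x) = fseries a x" for x
  proof -
    have "((\<lambda>n. cnj (a n * cis (of_int n * x))) has_sum cnj (fseries a x)) UNIV"
      using fseries_has_sum[OF a] by (simp only: has_sum_cnj_iff)
    moreover have "bij_betw uminus UNIV (UNIV :: int set)"
      by (rule bij_betwI[where g = uminus]) auto
    ultimately have "((\<lambda>n. cnj (a (- n) * cis (of_int (- n) * x))) has_sum cnj (fseries a x)) UNIV"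
      using has_sum_reindex_bij_betw by fastforce
    then have "((\<lambda>n. a n * cis (of_int n * x)) has_sum cnj (fseries a x)) UNIV"
      by (simp add: cnj cis_cnj)
    with fseries_has_sum[OF a] show ?thesis
      using has_sum_unique by blast
  qed
  then have "complex_of_real (Re (fseries a x)) = fseries a x" for x
    by (metis Reals_cnj_iff complex_is_Real_iff of_real_Re)
  with a show ?thesis
    by (simp add: wiener_rep_def)
qed

section \<open>Operations on functions and on their coefficients\<close>

lemma wiener_rep_mult:
  assumes "wiener_rep f a" "wiener_rep g b"
  shows "wiener_rep (\<lambda>x. f x * g x) (conv a b)"
  using assms by (simp add: wiener_rep_def fseries_conv conv_abs_summable)

lemma wiener_rep_cmult:
  assumes "wiener_rep f a"
  shows "wiener_rep (\<lambda>x. c * f x) (\<lambda>n. of_real c * a n)"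
  using assms by (auto simp: wiener_rep_def fseries_def norm_mult mult.assoc infsum_cmult_right'
      intro!: summable_on_cmult_right)

lemma wiener_rep_add:
  assumes "wiener_rep f a" "wiener_rep g b"
  shows "wiener_rep (\<lambda>x. f x + g x) (\<lambda>n. a n + b n)"
  unfolding wiener_rep_def
proof (intro conjI allI)
  have ab: "a abs_summable_on UNIV" "b abs_summable_on UNIV"
    using assms by (auto simp: wiener_rep_def)
  show "(\<lambda>n. a n + b n) abs_summable_on UNIV"
    by (rule Infinite_Sum.abs_summable_on_comparison_test'[OF summable_on_add[OF ab]]) (rule norm_triangle_ineq)
  show "complex_of_real (f x + g x) = fseries (\<lambda>n. a n + b n) x" for x
  proof -
    have "((\<lambda>n. (a n + b n) * cis (of_int n * x)) has_sum fseries a x + fseries b x) UNIV"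
      using has_sum_add[OF fseries_has_sum[OF ab(1)] fseries_has_sum[OF ab(2)]]
      by (simp add: distrib_right)
    then show ?thesis
      using assms by (simp add: wiener_rep_def fseries_def infsumI)
  qed
qed

lemma wiener_rep_diff:
  assumes "wiener_rep f a" "wiener_rep g b"
  shows "wiener_rep (\<lambda>x. f x - g x) (\<lambda>n. a n - b n)"
  using wiener_rep_add[OF assms(1) wiener_rep_cmult[OF assms(2), of "-1"]] by simp

lemma wiener_rep_translate:
  assumes "wiener_rep f a"
  shows "wiener_rep (\<lambda>x. f (x + t)) (\<lambda>n. a n * cis (of_int n * t))"
  using assms by (simp add: wiener_rep_def norm_mult fseries_def distrib_left mult_ac flip: cis_mult)

text \<open>The bound keeps coefficients absolutely summable; the symmetry expresses that the
  multiplier maps real functions to real functions.\<close>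

definition real_symbol :: "(int \<Rightarrow> complex) \<Rightarrow> bool" where
  "real_symbol \<mu> \<longleftrightarrow> (\<forall>n. norm (\<mu> n) \<le> 1 \<and> \<mu> (- n) = cnj (\<mu> n))"

text \<open>Resolves the definite description: the series with multiplied coefficients is a witness,
  and \<open>fourier_coeff_inject\<close> shows that it is the only one.\<close>

lemma wiener_rep_fourier_multiplier:
  assumes f: "wiener_rep f a" and "real_symbol \<mu>"
  shows "wiener_rep (fourier_multiplier \<mu> f) (\<lambda>n. \<mu> n * a n)"
proof -
  have bound: "norm (\<mu> n) \<le> 1" and sym: "\<mu> (- n) = cnj (\<mu> n)" for n
    using assms(2) by (simp_all add: real_symbol_def)
  have "(\<lambda>n. \<mu> n * a n) abs_summable_on UNIV"
    by (rule Infinite_Sum.abs_summable_on_comparison_test'[of "\<lambda>n. norm (a n)"])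
      (use f bound in \<open>auto simp: wiener_rep_def norm_mult mult_left_le_one_le\<close>)
  then have rep: "wiener_rep (\<lambda>x. Re (fseries (\<lambda>n. \<mu> n * a n) x)) (\<lambda>n. \<mu> n * a n)"
    by (rule wiener_rep_Re_fseries) (simp add: sym wiener_rep_cnj[OF f])
  have "fourier_multiplier \<mu> f = (\<lambda>x. Re (fseries (\<lambda>n. \<mu> n * a n) x))"
    unfolding fourier_multiplier_def
  proof (rule the_equality)
    show "continuous_on UNIV (\<lambda>x. Re (fseries (\<lambda>n. \<mu> n * a n) x)) \<and>
        two_pi_periodic (\<lambda>x. Re (fseries (\<lambda>n. \<mu> n * a n) x)) \<and>
        (\<forall>k. fourier_coeff (\<lambda>x. Re (fseries (\<lambda>n. \<mu> n * a n) x)) k = \<mu> k * fourier_coeff f k)"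
      using wiener_rep_continuous[OF rep] wiener_rep_two_pi_periodic[OF rep]
      by (simp add: wiener_rep_fourier_coeff[OF rep] wiener_rep_fourier_coeff[OF f])
  next
    fix g assume "continuous_on UNIV g \<and> two_pi_periodic g \<and>
        (\<forall>k. fourier_coeff g k = \<mu> k * fourier_coeff f k)"
    then show "g = (\<lambda>x. Re (fseries (\<lambda>n. \<mu> n * a n) x))"
      using wiener_rep_continuous[OF rep] wiener_rep_two_pi_periodic[OF rep]
      by (intro fourier_coeff_inject)
        (simp_all add: wiener_rep_fourier_coeff[OF rep] wiener_rep_fourier_coeff[OF f])
  qed
  with rep show ?thesis
    by simp
qed

text \<open>Termwise differentiation, justified by the M-test: the representation of
  \<open>g\<close> makes the differentiated series absolutely summable, uniformly in
  \<open>x\<close>.\<close>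

lemma wiener_rep_derivative:
  assumes f: "wiener_rep f a" and g: "wiener_rep g (\<lambda>n. \<i> * of_int n * a n)"
  shows "(f has_real_derivative g x) (at x)"
proof -
  \<comment> \<open>An enumeration of the integers, so that the differentiation theorem for series
    over the naturals applies.\<close>
  define d where "d = int_decode"
  have bij: "bij_betw d UNIV UNIV"
    unfolding d_def by (rule bij_int_decode)
  define F where "F n x = Re (a (d n) * cis (of_int (d n) * x))" for n x
  define F' where "F' n x = Re (\<i> * of_int (d n) * a (d n) * cis (of_int (d n) * x))" for n x
  have sums: "(\<lambda>n. Re (b (d n) * cis (of_int (d n) * x))) sums h x" if "wiener_rep h b" for h b x
  proof -
    have "((\<lambda>n. Re (b n * cis (of_int n * x))) has_sum Re (fseries b x)) UNIV"
      using that by (intro has_sum_Re fseries_has_sum) (simp add: wiener_rep_def)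
    moreover have "Re (fseries b x) = h x"
      using that unfolding wiener_rep_def by (metis Re_complex_of_real)
    ultimately have "((\<lambda>n. Re (b (d n) * cis (of_int (d n) * x))) has_sum h x) UNIV"
      using has_sum_reindex_bij_betw[OF bij, of "\<lambda>n. Re (b n * cis (of_int n * x))"] by simp
    then show ?thesis
      by (rule has_sum_imp_sums)
  qed
  have Fs: "F n = (\<lambda>x. Re (a (d n) * cis (of_int (d n) * x)))" for n
    by (simp add: F_def fun_eq_iff)
  have deriv: "(F n has_field_derivative F' n x) (at x within UNIV)" for n x
    unfolding has_real_derivative_iff_has_vector_derivative Fs F'_def
    using bounded_linear.has_vector_derivative[OF bounded_linear_Re
        has_vector_derivative_mult_right[OF cis_has_vector_derivative[of "of_int (d n)" x UNIV], of "a (d n)"]]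
    by (simp add: mult_ac)
  have "summable (\<lambda>n. norm (\<i> * of_int (d n) * a (d n)))"
    using g summable_on_reindex_bij_betw[OF bij, of "\<lambda>n. norm (\<i> * of_int n * a n)"]
    by (intro summable_on_imp_summable) (simp add: wiener_rep_def)
  moreover have "norm (F' n x) \<le> norm (\<i> * of_int (d n) * a (d n))" for n x
    unfolding F'_def real_norm_def
    by (rule order.trans[OF abs_Re_le_cmod]) (simp add: norm_mult)
  ultimately have "uniformly_convergent_on UNIV (\<lambda>n x. \<Sum>i<n. F' i x)"
    by (intro Weierstrass_m_test') auto
  from has_field_derivative_series'(2)[OF convex_UNIV deriv this]
  have "((\<lambda>x. \<Sum>n. F n x) has_field_derivative (\<Sum>n. F' n x)) (at x)"
    using sums[OF f] by (auto simp: F_def sums_iff)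
  moreover have "(\<lambda>x. \<Sum>n. F n x) = f"
    using sums[OF f] by (auto simp: F_def sums_iff)
  moreover have "(\<Sum>n. F' n x) = g x"
    using sums[OF g] by (auto simp: F'_def sums_iff)
  ultimately show ?thesis
    by simp
qed

text \<open>Integration by parts against a character; the boundary terms cancel by periodicity. It
  identifies the coefficients of derivatives that were computed by the product rule.\<close>

lemma wiener_rep_of_derivative:
  assumes f: "wiener_rep f a" and g: "wiener_rep g b"
    and deriv: "\<And>x. (f has_real_derivative g x) (at x)"
  shows "b n = \<i> * of_int n * a n"
proof -
  define e where "e x = cis (- (of_int n * x))" for x
  have e': "(e has_vector_derivative - \<i> * of_int n * e x) (at x within {0..2 * pi})" for x
    using cis_has_vector_derivative[of "- of_int n" x "{0..2 * pi}"] by (simp add: e_def[abs_def])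
  have f': "((\<lambda>x. complex_of_real (f x)) has_vector_derivative complex_of_real (g x)) (at x within {0..2 * pi})" for x
    using deriv[of x]
    by (intro has_vector_derivative_of_real has_vector_derivative_at_within)
      (simp add: has_real_derivative_iff_has_vector_derivative)
  have "((\<lambda>x. complex_of_real (f x) * (- \<i> * of_int n * e x) + complex_of_real (g x) * e x) has_integral
      complex_of_real (f (2 * pi)) * e (2 * pi) - complex_of_real (f 0) * e 0) {0..2 * pi}"
    by (rule fundamental_theorem_of_calculus, simp, rule has_vector_derivative_mult[OF f' e'])
  moreover have "e (2 * pi) = e 0"
    using cis_2pi_int[of "- n"] by (simp add: e_def)
  moreover have "f (2 * pi) = f 0"
    using wiener_rep_two_pi_periodic[OF f] unfolding two_pi_periodic_def by (metis add_0)
  ultimately have zero: "integral {0..2 * pi}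
      (\<lambda>x. complex_of_real (f x) * (- \<i> * of_int n * e x) + complex_of_real (g x) * e x) = 0"
    by (simp add: integral_unique)
  have ce: "continuous_on {0..2 * pi} e"
    unfolding e_def[abs_def] by (intro continuous_intros)
  have "(\<lambda>x. complex_of_real (f x) * (- \<i> * of_int n * e x)) integrable_on {0..2 * pi}"
    "(\<lambda>x. complex_of_real (g x) * e x) integrable_on {0..2 * pi}"
    by (intro integrable_continuous_real continuous_intros ce wiener_rep_continuous[OF f]
        wiener_rep_continuous[OF g])+
  from zero[unfolded integral_add[OF this]]
  have "integral {0..2 * pi} (\<lambda>x. complex_of_real (g x) * e x) =
      \<i> * of_int n * integral {0..2 * pi} (\<lambda>x. complex_of_real (f x) * e x)"
    by (simp add: mult.left_commute[of "complex_of_real _"] mult.assoc)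
  moreover have "a n = integral {0..2 * pi} (\<lambda>x. complex_of_real (f x) * e x) / (2 * pi)"
    "b n = integral {0..2 * pi} (\<lambda>x. complex_of_real (g x) * e x) / (2 * pi)"
    by (simp_all add: e_def fourier_coeff_cis flip: wiener_rep_fourier_coeff[OF f] wiener_rep_fourier_coeff[OF g])
  ultimately show ?thesis
    by simp
qed

section \<open>Weighted summable sequences\<close>

text \<open>The weight is submultiplicative, so that convolution is bounded, and dominates \<open>n\<^sup>2\<close>, so that the norm
  controls two derivatives.\<close>

abbreviation weight :: "int \<Rightarrow> real" where
  "weight n \<equiv> (1 + \<bar>of_int n\<bar>)\<^sup>2"

lemma weight_ge_1: "1 \<le> weight n"
  by (rule one_le_power) simp

lemma weight_submult: "weight n \<le> weight j * weight (n - j)"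
proof -
  have "\<bar>real_of_int n\<bar> \<le> \<bar>of_int j\<bar> + \<bar>of_int (n - j)\<bar>"
    using abs_triangle_ineq[of "real_of_int j" "of_int (n - j)"] by simp
  moreover have "0 \<le> \<bar>real_of_int j\<bar> * \<bar>of_int (n - j)\<bar>"
    by simp
  ultimately have "1 + \<bar>real_of_int n\<bar> \<le> (1 + \<bar>of_int j\<bar>) * (1 + \<bar>of_int (n - j)\<bar>)"
    unfolding ring_distribs by linarith
  then show ?thesis
    unfolding power_mult_distrib[symmetric] by (rule power_mono) simp
qed

text \<open>A type of its own, so that the sequences become an instance of \<open>banach\<close>.
  The values are real because the waves are cosine series.\<close>

typedef wseq = "{a :: int \<Rightarrow> real. (\<lambda>n. weight n * \<bar>a n\<bar>) summable_on UNIV}"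
  morphisms coef Wseq
  by (rule exI[of _ "\<lambda>_. 0"]) simp

setup_lifting type_definition_wseq

lemma coef_weighted_summable: "(\<lambda>n. weight n * \<bar>coef a n\<bar>) summable_on UNIV"
  using coef by simp

lemma wseq_eqI: "(\<And>n. coef a n = coef b n) \<Longrightarrow> a = b"
  using coef_inject by blast

lemma weighted_summable_dominated:
  assumes "f summable_on UNIV" "\<And>n. weight n * \<bar>a n\<bar> \<le> f n"
  shows "(\<lambda>n. weight n * \<bar>a n\<bar>) summable_on UNIV"
  by (rule summable_on_comparison_test[OF assms]) auto

lemma weighted_add_le: "weight n * \<bar>a + b\<bar> \<le> weight n * \<bar>a\<bar> + weight n * \<bar>b\<bar>"
  by (simp add: abs_triangle_ineq mult_left_mono flip: distrib_left)

lemma weighted_diff_le: "weight n * \<bar>a - b\<bar> \<le> weight n * \<bar>a\<bar> + weight n * \<bar>b\<bar>"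
  by (simp add: abs_triangle_ineq4 mult_left_mono flip: distrib_left)

section \<open>Banach space structure of the weighted sequences\<close>

instantiation wseq :: real_normed_vector
begin

lift_definition zero_wseq :: wseq is "\<lambda>_. 0"
  by simp

lift_definition plus_wseq :: "wseq \<Rightarrow> wseq \<Rightarrow> wseq" is "\<lambda>a b n. a n + b n"
  by (rule weighted_summable_dominated[OF summable_on_add weighted_add_le])

lift_definition minus_wseq :: "wseq \<Rightarrow> wseq \<Rightarrow> wseq" is "\<lambda>a b n. a n - b n"
  by (rule weighted_summable_dominated[OF summable_on_add weighted_diff_le])

lift_definition uminus_wseq :: "wseq \<Rightarrow> wseq" is "\<lambda>a n. - a n"
  by simp

lift_definition scaleR_wseq :: "real \<Rightarrow> wseq \<Rightarrow> wseq" is "\<lambda>r a n. r * a n"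
proof -
  fix r and a :: "int \<Rightarrow> real"
  assume "(\<lambda>n. weight n * \<bar>a n\<bar>) summable_on UNIV"
  from summable_on_cmult_right[OF this, of "\<bar>r\<bar>"]
  show "(\<lambda>n. weight n * \<bar>r * a n\<bar>) summable_on UNIV"
    by (simp add: abs_mult mult.left_commute)
qed

definition norm_wseq :: "wseq \<Rightarrow> real" where
  "norm_wseq a = (\<Sum>\<^sub>\<infinity>n. weight n * \<bar>coef a n\<bar>)"

definition dist_wseq :: "wseq \<Rightarrow> wseq \<Rightarrow> real" where
  "dist_wseq a b = norm (a - b)"

definition sgn_wseq :: "wseq \<Rightarrow> wseq" where
  "sgn_wseq a = scaleR (inverse (norm a)) a"

definition uniformity_wseq :: "(wseq \<times> wseq) filter" where
  "uniformity_wseq = (INF e\<in>{0<..}. principal {(x, y). dist x y < e})"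

definition open_wseq :: "wseq set \<Rightarrow> bool" where
  "open_wseq U \<longleftrightarrow> (\<forall>x\<in>U. \<forall>\<^sub>F (x', y) in uniformity. x' = x \<longrightarrow> y \<in> U)"

instance
proof
  fix a b c :: wseq and r s :: real
  show "a + b + c = a + (b + c)" "a + b = b + a" "0 + a = a" "- a + a = 0" "a - b = a + - b"
    "r *\<^sub>R (a + b) = r *\<^sub>R a + r *\<^sub>R b" "(r + s) *\<^sub>R a = r *\<^sub>R a + s *\<^sub>R a"
    "r *\<^sub>R s *\<^sub>R a = (r * s) *\<^sub>R a" "1 *\<^sub>R a = a"
    by (transfer, simp add: fun_eq_iff algebra_simps)+
  show "dist a b = norm (a - b)" "sgn a = inverse (norm a) *\<^sub>R a"
    by (simp_all add: dist_wseq_def sgn_wseq_def)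
  show "uniformity = (INF e\<in>{0<..}. principal {(x, y :: wseq). dist x y < e})"
    by (rule uniformity_wseq_def)
  show "open U \<longleftrightarrow> (\<forall>x\<in>U. \<forall>\<^sub>F (x', y) in uniformity. x' = x \<longrightarrow> y \<in> U)" for U :: "wseq set"
    by (rule open_wseq_def)
  show "norm a = 0 \<longleftrightarrow> a = 0"
  proof
    assume "norm a = 0"
    then have "weight n * \<bar>coef a n\<bar> = 0" for n
      by (intro nonneg_infsum_le_0D[OF _ coef_weighted_summable]) (simp_all add: norm_wseq_def)
    then have "coef a n = 0" for n
      using weight_ge_1[of n] by (metis abs_eq_0 mult_eq_0_iff not_one_le_zero)
    then show "a = 0"
      by (intro wseq_eqI) (simp add: zero_wseq.rep_eq)
  qed (simp add: norm_wseq_def zero_wseq.rep_eq)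
  show "norm (a + b) \<le> norm a + norm b"
    unfolding norm_wseq_def infsum_add[OF coef_weighted_summable coef_weighted_summable, symmetric]
    by (intro infsum_mono summable_on_add coef_weighted_summable)
      (simp add: plus_wseq.rep_eq weighted_add_le)
  show "norm (r *\<^sub>R a) = \<bar>r\<bar> * norm a"
    unfolding norm_wseq_def scaleR_wseq.rep_eq
    by (simp add: abs_mult mult.left_commute infsum_cmult_right' flip: infsum_cmult_right')
qed

end

lemmas coef_simps [simp] =
  zero_wseq.rep_eq plus_wseq.rep_eq minus_wseq.rep_eq uminus_wseq.rep_eq scaleR_wseq.rep_eq

lemma norm_wseq_le:
  assumes "\<And>F. finite F \<Longrightarrow> (\<Sum>n\<in>F. weight n * \<bar>coef a n\<bar>) \<le> B"
  shows "norm a \<le> B"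
  unfolding norm_wseq_def by (rule infsum_le_finite_sums[OF coef_weighted_summable]) (use assms in auto)

lemma sum_le_norm_wseq:
  assumes "finite F"
  shows "(\<Sum>n\<in>F. weight n * \<bar>coef a n\<bar>) \<le> norm a"
  unfolding norm_wseq_def by (rule finite_sum_le_infsum[OF coef_weighted_summable assms]) auto

lemma abs_coef_le: "\<bar>coef a n\<bar> \<le> norm a"
proof -
  have "\<bar>coef a n\<bar> \<le> weight n * \<bar>coef a n\<bar>"
    using weight_ge_1[of n] by (simp add: mult_le_cancel_right1)
  also have "\<dots> \<le> norm a"
    using sum_le_norm_wseq[of "{n}" a] by simp
  finally show ?thesis .
qed

lemma bounded_linear_coef: "bounded_linear (\<lambda>a. coef a n)"
  by (rule bounded_linear_intro[where K = 1]) (simp_all add: abs_coef_le)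

instance wseq :: banach
proof
  fix X :: "nat \<Rightarrow> wseq"
  assume X: "Cauchy X"
  have "Cauchy (\<lambda>i. coef (X i) n)" for n
    by (rule bounded_linear.Cauchy[OF bounded_linear_coef X])
  then have "\<exists>l. (\<lambda>i. coef (X i) n) \<longlonglongrightarrow> l" for n
    by (simp add: Cauchy_convergent_iff convergent_def)
  then obtain l where l: "\<And>n. (\<lambda>i. coef (X i) n) \<longlonglongrightarrow> l n"
    by metis
  \<comment> \<open>The Cauchy estimate with its second index sent to infinity. It is stated for
    finite sums, uniformly in the set, because the limit \<open>l\<close> is not yet known to be
    weighted summable.\<close>
  have tail: "\<exists>N. \<forall>i\<ge>N. \<forall>F. finite F \<longrightarrow> (\<Sum>n\<in>F. weight n * \<bar>coef (X i) n - l n\<bar>) \<le> e"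
    if "e > 0" for e
  proof -
    obtain N where N: "\<And>i j. i \<ge> N \<Longrightarrow> j \<ge> N \<Longrightarrow> norm (X i - X j) < e"
      using X \<open>e > 0\<close> unfolding Cauchy_iff by blast
    have "(\<Sum>n\<in>F. weight n * \<bar>coef (X i) n - l n\<bar>) \<le> e" if "i \<ge> N" "finite F" for i F
    proof (rule tendsto_upperbound)
      show "(\<lambda>j. \<Sum>n\<in>F. weight n * \<bar>coef (X i) n - coef (X j) n\<bar>) \<longlonglongrightarrow>
          (\<Sum>n\<in>F. weight n * \<bar>coef (X i) n - l n\<bar>)"
        by (intro tendsto_intros l)
      have "(\<Sum>n\<in>F. weight n * \<bar>coef (X i) n - coef (X j) n\<bar>) \<le> e" if "j \<ge> N" for j
        using sum_le_norm_wseq[OF \<open>finite F\<close>, of "X i - X j"] N[OF \<open>i \<ge> N\<close> that] by simp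
      then show "\<forall>\<^sub>F j in sequentially. (\<Sum>n\<in>F. weight n * \<bar>coef (X i) n - coef (X j) n\<bar>) \<le> e"
        by (auto simp: eventually_sequentially)
    qed simp
    then show ?thesis
      by blast
  qed
  obtain N where N: "\<And>F. finite F \<Longrightarrow> (\<Sum>n\<in>F. weight n * \<bar>coef (X N) n - l n\<bar>) \<le> 1"
    using tail[of 1] by auto
  have "(\<lambda>n. weight n * \<bar>coef (X N) n - l n\<bar>) summable_on UNIV"
    by (rule nonneg_bdd_above_summable_on) (auto intro!: bdd_aboveI2 N)
  from summable_on_add[OF coef_weighted_summable[of "X N"] this]
  have "(\<lambda>n. weight n * \<bar>l n\<bar>) summable_on UNIV"
  proof (rule weighted_summable_dominated)
    show "weight n * \<bar>l n\<bar> \<le> weight n * \<bar>coef (X N) n\<bar> + weight n * \<bar>coef (X N) n - l n\<bar>" for n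
      using weighted_diff_le[of n "coef (X N) n" "coef (X N) n - l n"] by simp
  qed
  then have L: "coef (Wseq l) n = l n" for n
    by (simp add: Wseq_inverse)
  have "X \<longlonglongrightarrow> Wseq l"
  proof (rule LIMSEQ_I)
    fix r :: real assume "r > 0"
    then obtain N where "\<And>i F. i \<ge> N \<Longrightarrow> finite F \<Longrightarrow> (\<Sum>n\<in>F. weight n * \<bar>coef (X i) n - l n\<bar>) \<le> r / 2"
      using tail[of "r / 2"] by auto
    then have "norm (X i - Wseq l) \<le> r / 2" if "i \<ge> N" for i
      using that by (intro norm_wseq_le) (simp add: L)
    then show "\<exists>N. \<forall>i\<ge>N. norm (X i - Wseq l) < r"
      using \<open>r > 0\<close> by (intro exI[of _ N]) (force intro: le_less_trans)
  qed
  then show "convergent X"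
    by (rule convergentI)
qed

text \<open>Fourier multipliers on coefficient sequences. The default 0 for unbounded symbols makes
  the operation total, as lifting requires a weighted summable result for every symbol.\<close>

lift_definition diag :: "(int \<Rightarrow> real) \<Rightarrow> wseq \<Rightarrow> wseq" is
  "\<lambda>t a n. if bounded (range t) then t n * a n else 0"
proof -
  fix t a :: "int \<Rightarrow> real"
  assume a: "(\<lambda>n. weight n * \<bar>a n\<bar>) summable_on UNIV"
  show "(\<lambda>n. weight n * \<bar>if bounded (range t) then t n * a n else 0\<bar>) summable_on UNIV"
  proof (cases "bounded (range t)")
    case True
    then obtain K where K: "\<And>n. \<bar>t n\<bar> \<le> K"
      by (auto simp: bounded_iff)
    have "weight n * \<bar>t n * a n\<bar> \<le> K * (weight n * \<bar>a n\<bar>)" for n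
      using mult_right_mono[OF K[of n], of "weight n * \<bar>a n\<bar>"] by (simp add: abs_mult mult_ac)
    with True show ?thesis
      using weighted_summable_dominated[OF summable_on_cmult_right[OF a, of K], of "\<lambda>n. t n * a n"] by simp
  qed simp
qed

lemma bounded_rangeI:
  fixes t :: "int \<Rightarrow> real"
  shows "(\<And>n. \<bar>t n\<bar> \<le> K) \<Longrightarrow> bounded (range t)"
  by (auto simp: bounded_iff)

lemma coef_diag:
  assumes "\<And>n. \<bar>t n\<bar> \<le> K"
  shows "coef (diag t a) n = t n * coef a n"
  by (simp add: diag.rep_eq bounded_rangeI[OF assms])

lemma norm_diag_le:
  assumes "\<And>n. \<bar>t n\<bar> \<le> K"
  shows "norm (diag t a) \<le> K * norm a"
proof (rule norm_wseq_le)
  fix F :: "int set" assume "finite F"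
  have "(\<Sum>n\<in>F. weight n * \<bar>coef (diag t a) n\<bar>) \<le> (\<Sum>n\<in>F. K * (weight n * \<bar>coef a n\<bar>))"
  proof (rule sum_mono)
    fix n
    show "weight n * \<bar>coef (diag t a) n\<bar> \<le> K * (weight n * \<bar>coef a n\<bar>)"
      using mult_right_mono[OF assms[of n], of "weight n * \<bar>coef a n\<bar>"]
      by (simp add: coef_diag[OF assms] abs_mult mult_ac)
  qed
  also have "\<dots> \<le> K * norm a"
    using sum_le_norm_wseq[OF \<open>finite F\<close>, of a] assms[of 0]
    by (simp add: mult_left_mono flip: sum_distrib_left)
  finally show "(\<Sum>n\<in>F. weight n * \<bar>coef (diag t a) n\<bar>) \<le> K * norm a" .
qed

lemma linear_diag: "linear (diag t)"
  by (rule linearI; rule wseq_eqI) (simp_all add: diag.rep_eq distrib_left)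

lemmas diag_simps = linear_add[OF linear_diag] linear_diff[OF linear_diag] linear_scale[OF linear_diag]

text \<open>By submultiplicativity of the weight, the weighted convolution is dominated by the
  convolution of the weighted sequences, whose total sum is the product of the two sums.\<close>

lemma conv_weighted:
  fixes a b :: "int \<Rightarrow> real"
  assumes a: "(\<lambda>n. weight n * \<bar>a n\<bar>) summable_on UNIV" and b: "(\<lambda>n. weight n * \<bar>b n\<bar>) summable_on UNIV"
  shows "(\<lambda>n. weight n * \<bar>conv a b n\<bar>) summable_on UNIV"
    and "(\<Sum>\<^sub>\<infinity>n. weight n * \<bar>conv a b n\<bar>) \<le>
      (\<Sum>\<^sub>\<infinity>n. weight n * \<bar>a n\<bar>) * (\<Sum>\<^sub>\<infinity>n. weight n * \<bar>b n\<bar>)"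
proof -
  define a' b' where "a' n = weight n * \<bar>a n\<bar>" and "b' n = weight n * \<bar>b n\<bar>" for n
  have ab': "a' abs_summable_on UNIV" "b' abs_summable_on UNIV"
    using a b by (simp_all add: a'_def b'_def)
  have le: "weight n * \<bar>conv a b n\<bar> \<le> conv a' b' n" for n
  proof -
    have term_le: "weight n * \<bar>a j * b (n - j)\<bar> \<le> a' j * b' (n - j)" for j
      using mult_right_mono[OF weight_submult[of n j], of "\<bar>a j * b (n - j)\<bar>"]
      by (simp add: a'_def b'_def abs_mult mult_ac)
    have s: "(\<lambda>j. a' j * b' (n - j)) summable_on UNIV"
      by (rule abs_summable_summable[OF conv_terms_abs_summable[OF ab']])
    have "(\<lambda>j. weight n * (a j * b (n - j))) abs_summable_on UNIV"
      by (rule Infinite_Sum.abs_summable_on_comparison_test'[OF s])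
        (use term_le in \<open>simp add: abs_mult\<close>)
    from has_sum_infsum[OF abs_summable_summable[OF this]] has_sum_infsum[OF s]
    have "norm (\<Sum>\<^sub>\<infinity>j. weight n * (a j * b (n - j))) \<le> (\<Sum>\<^sub>\<infinity>j. a' j * b' (n - j))"
      by (rule norm_infsum_le) (use term_le in \<open>simp add: abs_mult\<close>)
    then show ?thesis
      by (simp add: conv_def infsum_cmult_right' abs_mult)
  qed
  have s: "conv a' b' summable_on UNIV"
    by (rule abs_summable_summable[OF conv_abs_summable[OF ab']])
  from s le show *: "(\<lambda>n. weight n * \<bar>conv a b n\<bar>) summable_on UNIV"
    by (rule weighted_summable_dominated)
  show "(\<Sum>\<^sub>\<infinity>n. weight n * \<bar>conv a b n\<bar>) \<le>
      (\<Sum>\<^sub>\<infinity>n. weight n * \<bar>a n\<bar>) * (\<Sum>\<^sub>\<infinity>n. weight n * \<bar>b n\<bar>)"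
    using infsum_mono[OF * s le] infsum_conv[OF ab'] by (simp add: a'_def[abs_def] b'_def[abs_def])
qed

lift_definition wconv :: "wseq \<Rightarrow> wseq \<Rightarrow> wseq" is conv
  by (rule conv_weighted(1))

lemma norm_wconv_le: "norm (wconv a b) \<le> norm a * norm b"
  unfolding norm_wseq_def wconv.rep_eq by (intro conv_weighted(2) coef_weighted_summable)

lemma coef_abs_summable: "coef a abs_summable_on UNIV"
proof (rule Infinite_Sum.abs_summable_on_comparison_test'[OF coef_weighted_summable[of a]])
  show "norm (coef a n) \<le> weight n * \<bar>coef a n\<bar>" for n
    using weight_ge_1[of n] by (simp add: mult_le_cancel_right1)
qed

lemma conv_terms_summable: "(\<lambda>j. coef a j * coef b (n - j)) summable_on UNIV"
  by (rule abs_summable_summable[OF conv_terms_abs_summable[OF coef_abs_summable coef_abs_summable]])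

lemma bounded_bilinear_wconv: "bounded_bilinear wconv"
proof
  show "wconv (a + a') b = wconv a b + wconv a' b" "wconv b (a + a') = wconv b a + wconv b a'" for a a' b
    by (rule wseq_eqI; simp add: wconv.rep_eq conv_def distrib_left distrib_right infsum_add conv_terms_summable)+
  show "wconv (r *\<^sub>R a) b = r *\<^sub>R wconv a b" "wconv a (r *\<^sub>R b) = r *\<^sub>R wconv a b" for r a b
    by (rule wseq_eqI; simp add: wconv.rep_eq conv_def mult.assoc mult.left_commute[of _ r] infsum_cmult_right')+
  show "\<exists>K. \<forall>a b. norm (wconv a b) \<le> norm a * norm b * K"
    using norm_wconv_le by (intro exI[of _ 1]) simp
qed

text \<open>For \<open>m \<ge> 1\<close> these are the coefficients of even functions of period
  \<open>2 * pi / m\<close>. Evenness makes the modes \<open>m\<close> and \<open>- m\<close> carry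
  the same equation, so that the single unknown speed settles both.\<close>

definition even_multiples :: "int \<Rightarrow> wseq \<Rightarrow> bool" where
  "even_multiples m a \<longleftrightarrow> (\<forall>n. coef a (- n) = coef a n \<and> (\<not> m dvd n \<longrightarrow> coef a n = 0))"

text \<open>The sign \<open>\<sigma>\<close> is 1 for even and -1 for odd sequences; two equal
  parities convolve to an even sequence. The odd case occurs for \<open>smooth_deriv\<close>, which
  reverses parity.\<close>

lemma conv_parity:
  fixes a b :: "int \<Rightarrow> real"
  assumes "\<And>n. a (- n) = \<sigma> * a n" "\<And>n. b (- n) = \<sigma> * b n" "\<sigma> * \<sigma> = 1"
  shows "conv a b (- n) = conv a b n"
proof -
  have "bij_betw uminus UNIV (UNIV :: int set)"
    by (rule bij_betwI[where g = uminus]) auto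
  from infsum_reindex_bij_betw[OF this, of "\<lambda>j. a j * b (- n - j)"]
  have "conv a b (- n) = (\<Sum>\<^sub>\<infinity>j. a (- j) * b (- (n - j)))"
    by (simp add: conv_def)
  also have "\<dots> = (\<Sum>\<^sub>\<infinity>j. (\<sigma> * \<sigma>) * (a j * b (n - j)))"
    by (simp only: assms(1,2) mult_ac)
  finally show ?thesis
    by (simp add: conv_def assms(3))
qed

text \<open>If \<open>m\<close> does not divide \<open>n\<close>, it cannot divide both
  \<open>j\<close> and \<open>n - j\<close>.\<close>

lemma conv_eq_0_of_not_dvd:
  fixes a b :: "int \<Rightarrow> real"
  assumes "\<And>n. \<not> m dvd n \<Longrightarrow> a n = 0" "\<And>n. \<not> m dvd n \<Longrightarrow> b n = 0" "\<not> m dvd n"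
  shows "conv a b n = 0"
proof -
  have "a j * b (n - j) = 0" for j
  proof (cases "m dvd j")
    case True
    with assms(3) have "\<not> m dvd n - j"
      using dvd_add[of m "n - j" j] by auto
    then show ?thesis
      by (simp add: assms(2))
  qed (simp add: assms(1))
  then show ?thesis
    unfolding conv_def by (rule infsum_0)
qed

section \<open>Bifurcation from the mode m\<close>

abbreviation helmholtz_symbol :: "int \<Rightarrow> real" where
  "helmholtz_symbol n \<equiv> 1 / (1 + (of_int n)\<^sup>2)"

lemma one_plus_square_pos: "0 < 1 + (real_of_int n)\<^sup>2"
  by (simp add: add_pos_nonneg)

lemma abs_helmholtz_symbol_le: "\<bar>helmholtz_symbol n\<bar> \<le> 1"
  using one_plus_square_pos[of n] by simp

lemma abs_helmholtz_derivative_symbol_le: "\<bar>of_int n * helmholtz_symbol n\<bar> \<le> 1"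
proof -
  have "0 \<le> (1 - \<bar>real_of_int n\<bar>)\<^sup>2"
    by simp
  then have "\<bar>real_of_int n\<bar> \<le> 1 + (of_int n)\<^sup>2"
    by (simp add: power2_diff)
  then show ?thesis
    using one_plus_square_pos[of n] by (simp add: abs_mult)
qed

definition smooth :: "wseq \<Rightarrow> wseq" where
  "smooth = diag helmholtz_symbol"

definition smooth_deriv :: "wseq \<Rightarrow> wseq" where
  "smooth_deriv = diag (\<lambda>n. of_int n * helmholtz_symbol n)"

lemma coef_smooth: "coef (smooth a) n = helmholtz_symbol n * coef a n"
  and norm_smooth_le: "norm (smooth a) \<le> norm a"
  unfolding smooth_def using coef_diag[where t = helmholtz_symbol, OF abs_helmholtz_symbol_le]
    norm_diag_le[where t = helmholtz_symbol, OF abs_helmholtz_symbol_le, of a]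
  by simp_all

lemma coef_smooth_deriv: "coef (smooth_deriv a) n = of_int n * helmholtz_symbol n * coef a n"
  and norm_smooth_deriv_le: "norm (smooth_deriv a) \<le> norm a"
  unfolding smooth_deriv_def
  using coef_diag[where t = "\<lambda>n. of_int n * helmholtz_symbol n", OF abs_helmholtz_derivative_symbol_le]
    norm_diag_le[where t = "\<lambda>n. of_int n * helmholtz_symbol n", OF abs_helmholtz_derivative_symbol_le, of a]
  by simp_all

text \<open>On even sequences the function with coefficients \<open>smooth_deriv a\<close> is, up to the factor \<open>\<i>\<close>, the derivative of
  the one with coefficients \<open>smooth a\<close>, whence the plus sign in front of \<open>wconv (smooth_deriv a) (smooth_deriv b)\<close>.\<close>

definition quad :: "wseq \<Rightarrow> wseq \<Rightarrow> wseq" where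
  "quad a b = (3 / 2) *\<^sub>R wconv a b - (1 / 2) *\<^sub>R wconv (smooth a) (smooth b) +
     (1 / 2) *\<^sub>R smooth (wconv (smooth a) (smooth b) + wconv (smooth_deriv a) (smooth_deriv b))"

text \<open>The smoothing operators do not increase the norm, so the constant is 3/2 + 1/2 + (1 +
  1)/2.\<close>

lemma norm_quad_le: "norm (quad a b) \<le> 3 * (norm a * norm b)"
proof -
  have AA: "norm (wconv (smooth a) (smooth b)) \<le> norm a * norm b"
    by (rule order.trans[OF norm_wconv_le mult_mono]) (simp_all add: norm_smooth_le)
  have DD: "norm (wconv (smooth_deriv a) (smooth_deriv b)) \<le> norm a * norm b"
    by (rule order.trans[OF norm_wconv_le mult_mono]) (simp_all add: norm_smooth_deriv_le)
  have "norm (smooth (wconv (smooth a) (smooth b) + wconv (smooth_deriv a) (smooth_deriv b))) \<le> norm a * norm b + norm a * norm b"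
    by (rule order.trans[OF norm_smooth_le norm_triangle_le]) (use AA DD in simp)
  moreover have "norm (wconv a b) \<le> norm a * norm b"
    by (rule norm_wconv_le)
  moreover have "norm (quad a b) \<le> norm ((3 / 2) *\<^sub>R wconv a b) + norm ((1 / 2) *\<^sub>R wconv (smooth a) (smooth b)) +
      norm ((1 / 2) *\<^sub>R smooth (wconv (smooth a) (smooth b) + wconv (smooth_deriv a) (smooth_deriv b)))"
    unfolding quad_def by (intro norm_triangle_le add_mono norm_triangle_ineq4 order_refl)
  ultimately show ?thesis
    using AA by simp
qed

lemma bounded_bilinear_quad: "bounded_bilinear quad"
proof -
  interpret w: bounded_bilinear wconv
    by (rule bounded_bilinear_wconv)
  show ?thesis
  proof
    show "quad (a + a') b = quad a b + quad a' b" "quad b (a + a') = quad b a + quad b a'" for a a' b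
      unfolding quad_def smooth_def smooth_deriv_def
      by (simp_all add: diag_simps w.add_left w.add_right scaleR_add_right)
    show "quad (r *\<^sub>R a) b = r *\<^sub>R quad a b" "quad a (r *\<^sub>R b) = r *\<^sub>R quad a b" for r a b
      unfolding quad_def smooth_def smooth_deriv_def
      by (simp_all add: diag_simps w.scaleR_left w.scaleR_right scaleR_add_right scaleR_diff_right mult.commute)
    show "\<exists>K. \<forall>a b. norm (quad a b) \<le> norm a * norm b * K"
      using norm_quad_le by (intro exI[of _ 3]) (simp add: mult.commute)
  qed
qed

interpretation quad: bounded_bilinear quad
  by (rule bounded_bilinear_quad)

lemma coef_quad:
  "coef (quad a b) n = 3 / 2 * conv (coef a) (coef b) n - conv (coef (smooth a)) (coef (smooth b)) n / 2 +
     helmholtz_symbol n * (conv (coef (smooth a)) (coef (smooth b)) n + conv (coef (smooth_deriv a)) (coef (smooth_deriv b)) n) / 2"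
  by (simp add: quad_def coef_smooth wconv.rep_eq)

lemma even_multiples_quad:
  assumes "even_multiples m a" "even_multiples m b"
  shows "even_multiples m (quad a b)"
proof -
  have ev: "conv (coef a) (coef b) (- n) = conv (coef a) (coef b) n"
    "conv (coef (smooth a)) (coef (smooth b)) (- n) = conv (coef (smooth a)) (coef (smooth b)) n" for n
    by (rule conv_parity[where \<sigma> = 1]; use assms in \<open>simp add: even_multiples_def coef_smooth\<close>)+
  have odd: "conv (coef (smooth_deriv a)) (coef (smooth_deriv b)) (- n) = conv (coef (smooth_deriv a)) (coef (smooth_deriv b)) n" for n
    by (rule conv_parity[where \<sigma> = "-1"]) (use assms in \<open>simp_all add: even_multiples_def coef_smooth_deriv\<close>)
  have "conv (coef a) (coef b) n = 0" "conv (coef (smooth a)) (coef (smooth b)) n = 0"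
    "conv (coef (smooth_deriv a)) (coef (smooth_deriv b)) n = 0" if "\<not> m dvd n" for n
    by (rule conv_eq_0_of_not_dvd[of m]; use assms that in \<open>simp add: even_multiples_def coef_smooth coef_smooth_deriv\<close>)+
  then show ?thesis
    by (simp add: even_multiples_def coef_quad ev odd)
qed

lemma even_multiples_add: "even_multiples m a \<Longrightarrow> even_multiples m b \<Longrightarrow> even_multiples m (a + b)"
  and even_multiples_diff: "even_multiples m a \<Longrightarrow> even_multiples m b \<Longrightarrow> even_multiples m (a - b)"
  and even_multiples_scaleR: "even_multiples m a \<Longrightarrow> even_multiples m (r *\<^sub>R a)"
  by (simp_all add: even_multiples_def)

text \<open>For \<open>m \<noteq> 0\<close> the coefficients of \<open>2 cos (m x)\<close>, the
  kernel direction of the linear part.\<close>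

definition mode :: "int \<Rightarrow> wseq" where
  "mode m = Wseq (\<lambda>n. if n = m \<or> n = - m then 1 else 0)"

lemma coef_mode: "coef (mode m) n = (if n = m \<or> n = - m then 1 else 0)"
proof -
  have "(\<lambda>n. weight n * \<bar>if n = m \<or> n = - m then 1 else 0\<bar>) summable_on UNIV"
    by (rule finite_nonzero_values_imp_summable_on) (rule finite_subset[of _ "{m, - m}"], auto)
  then show ?thesis
    by (simp add: mode_def Wseq_inverse)
qed

lemma even_multiples_mode: "even_multiples m (mode m)"
  by (auto simp: even_multiples_def coef_mode)

text \<open>Inverts the linear part away from its kernel. The value 0 at \<open>m\<close> and
  \<open>- m\<close> removes the kernel component, so that fixed points of the map below have no
  such modes.\<close>

definition inverse_symbol :: "int \<Rightarrow> int \<Rightarrow> real" where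
  "inverse_symbol m n =
     (if n = m \<or> n = - m then 0 else 1 / (helmholtz_symbol n - helmholtz_symbol m))"

lemma helmholtz_symbol_neq:
  assumes "n \<noteq> m" "n \<noteq> - m"
  shows "helmholtz_symbol n \<noteq> helmholtz_symbol m"
proof -
  have "n\<^sup>2 \<noteq> m\<^sup>2"
    using assms by (auto simp: power2_eq_iff)
  then have "(real_of_int n)\<^sup>2 \<noteq> (real_of_int m)\<^sup>2"
    by (simp flip: of_int_power)
  then show ?thesis
    by simp
qed

text \<open>The difference of symbols is \<open>d / ((1 + n\<^sup>2) (1 + m\<^sup>2))\<close> with
  the nonzero integer \<open>d = m\<^sup>2 - n\<^sup>2\<close>. Since \<open>d\<close> has modulus
  at least 1 and \<open>1 + n\<^sup>2 = 1 + m\<^sup>2 - d\<close>, the reciprocal stays bounded as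
  \<open>n\<close> grows.\<close>

lemma abs_inverse_symbol_le:
  "\<bar>inverse_symbol m n\<bar> \<le> (1 + (of_int m)\<^sup>2) * (2 + (of_int m)\<^sup>2)"
proof (cases "n = m \<or> n = - m")
  case False
  define d where "d = m\<^sup>2 - n\<^sup>2"
  have "d \<noteq> 0"
    using False by (auto simp: d_def power2_eq_iff)
  then have d: "1 \<le> \<bar>real_of_int d\<bar>"
    by (simp flip: of_int_abs)
  have n: "1 + (real_of_int n)\<^sup>2 = (1 + (of_int m)\<^sup>2) - of_int d"
    by (simp add: d_def)
  have "\<bar>inverse_symbol m n\<bar> = (1 + (of_int m)\<^sup>2) * ((1 + (of_int n)\<^sup>2) / \<bar>real_of_int d\<bar>)"
    using False one_plus_square_pos[of n] one_plus_square_pos[of m] \<open>d \<noteq> 0\<close>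
    by (simp add: inverse_symbol_def d_def diff_divide_eq_iff divide_diff_eq_iff abs_mult)
  also have "(1 + (of_int n)\<^sup>2) / \<bar>real_of_int d\<bar> \<le> 2 + (of_int m)\<^sup>2"
  proof -
    have "1 + (real_of_int n)\<^sup>2 \<le> (1 + (of_int m)\<^sup>2) * \<bar>real_of_int d\<bar> + \<bar>real_of_int d\<bar>"
      using n mult_left_mono[OF d, of "1 + (real_of_int m)\<^sup>2"] by simp
    also have "\<dots> = (2 + (of_int m)\<^sup>2) * \<bar>real_of_int d\<bar>"
      by (simp add: algebra_simps)
    finally show ?thesis
      using d by (simp add: pos_divide_le_eq)
  qed
  finally show ?thesis
    by (simp add: mult_left_mono)
qed (simp add: inverse_symbol_def)

lemma coef_inverse_symbol: "coef (diag (inverse_symbol m) a) n = inverse_symbol m n * coef a n"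
  by (rule coef_diag[OF abs_inverse_symbol_le])

text \<open>A Lyapunov-Schmidt reduction: the coefficient of \<open>quad\<close> at \<open>m\<close>
  is the correction of the speed that mode \<open>m\<close> forces, and the other modes, divided by
  \<open>s\<close>, are solved for \<open>y\<close>.\<close>

definition bifurcation_map :: "int \<Rightarrow> real \<Rightarrow> wseq \<Rightarrow> wseq" where
  "bifurcation_map m s y = s *\<^sub>R diag (inverse_symbol m)
     (quad (mode m + y) (mode m + y) - coef (quad (mode m + y) (mode m + y)) m *\<^sub>R y)"

text \<open>At \<open>m\<close> and \<open>- m\<close> the difference of symbols and
  \<open>y\<close> vanish and the equation holds by the choice of \<open>\<nu>\<close>; at the other
  modes the inverse symbol is undone. That mode \<open>m\<close> has coefficient exactly
  \<open>s\<close> later tells the waves apart.\<close>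

lemma bifurcation_map_fixed_point:
  assumes fixed: "bifurcation_map m s y = y" and y: "even_multiples m y"
  defines "\<nu> \<equiv> coef (quad (mode m + y) (mode m + y)) m"
  defines "a \<equiv> s *\<^sub>R (mode m + y)"
  shows "coef a m = s"
    and "coef (quad a a) n = (helmholtz_symbol n - helmholtz_symbol m + s * \<nu>) * coef a n"
proof -
  have y_eq: "coef y n = s * (inverse_symbol m n * (coef (quad (mode m + y) (mode m + y)) n - \<nu> * coef y n))" for n
    using arg_cong[OF fixed, of "\<lambda>y. coef y n"]
    by (simp add: bifurcation_map_def coef_inverse_symbol \<nu>_def)
  have y0: "coef y n = 0" if "n = m \<or> n = - m" for n
    using y_eq[of n] that by (simp add: inverse_symbol_def)
  then show "coef a m = s"
    by (simp add: a_def coef_mode)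
  have "s * coef (quad (mode m + y) (mode m + y)) n =
      (helmholtz_symbol n - helmholtz_symbol m + s * \<nu>) * coef (mode m + y) n"
  proof (cases "n = m \<or> n = - m")
    case True
    have "coef (quad (mode m + y) (mode m + y)) n = \<nu>"
      using True even_multiples_quad[OF even_multiples_add even_multiples_add, OF even_multiples_mode y even_multiples_mode y]
      by (auto simp: \<nu>_def even_multiples_def)
    moreover have "helmholtz_symbol n = helmholtz_symbol m"
      using True by auto
    ultimately show ?thesis
      using True y0 by (simp add: coef_mode)
  next
    case False
    then have "helmholtz_symbol n - helmholtz_symbol m \<noteq> 0"
      using helmholtz_symbol_neq by auto
    moreover have "coef y n = s * (1 / (helmholtz_symbol n - helmholtz_symbol m) *
        (coef (quad (mode m + y) (mode m + y)) n - \<nu> * coef y n))"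
      using y_eq[of n] False by (simp add: inverse_symbol_def)
    ultimately have "(helmholtz_symbol n - helmholtz_symbol m) * coef y n =
        s * (coef (quad (mode m + y) (mode m + y)) n - \<nu> * coef y n)"
      by (metis (no_types, lifting) mult.left_commute mult.left_neutral nonzero_mult_div_cancel_left times_divide_eq_left times_divide_eq_right)
    with False show ?thesis
      by (simp add: coef_mode algebra_simps)
  qed
  then show "coef (quad a a) n = (helmholtz_symbol n - helmholtz_symbol m + s * \<nu>) * coef a n"
    by (simp add: a_def quad.scaleR_left quad.scaleR_right mult_ac)
qed

lemma even_multiples_bifurcation_map:
  assumes "even_multiples m y"
  shows "even_multiples m (bifurcation_map m s y)"
proof -
  have "even_multiples m (diag (inverse_symbol m) a)" if "even_multiples m a" for a
  proof -
    have "inverse_symbol m (- n) = inverse_symbol m n" for n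
      by (auto simp: inverse_symbol_def)
    with that show ?thesis
      by (simp add: even_multiples_def coef_inverse_symbol)
  qed
  then show ?thesis
    unfolding bifurcation_map_def
    by (simp add: even_multiples_scaleR even_multiples_diff even_multiples_quad even_multiples_add
        even_multiples_mode assms)
qed

text \<open>Makes the domain of the contraction complete.\<close>

lemma closed_even_multiples: "closed {y. even_multiples m y}"
proof -
  have [continuous_intros]: "continuous_on UNIV (\<lambda>a. coef a n)" for n
    by (rule linear_continuous_on[OF bounded_linear_coef])
  have "{y. even_multiples m y} =
      (\<Inter>n. {y. coef y (- n) = coef y n} \<inter> {y. \<not> m dvd n \<longrightarrow> coef y n = 0})"
    by (auto simp: even_multiples_def)
  moreover have "closed {y. \<not> m dvd n \<longrightarrow> coef y n = 0}" for n
    by (cases "m dvd n") (auto intro!: closed_Collect_eq continuous_intros)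
  ultimately show ?thesis
    by (auto intro!: closed_INT closed_Int closed_Collect_eq continuous_intros)
qed

text \<open>Banach's fixed point theorem in the even sequences of norm at most 1, for each small
  \<open>s\<close>. The contraction factor 1/2 is uniform in \<open>s\<close>, so the fixed point is
  Lipschitz in \<open>s\<close>.\<close>

lemma bifurcation_curve:
  obtains \<epsilon> y where "\<epsilon> > 0" "continuous_on {0<..<\<epsilon>} y"
    "\<And>s. s \<in> {0<..<\<epsilon>} \<Longrightarrow> even_multiples m (y s)"
    "\<And>s. s \<in> {0<..<\<epsilon>} \<Longrightarrow> bifurcation_map m s (y s) = y s"
proof -
  define C where "C = (1 + (real_of_int m)\<^sup>2) * (2 + (real_of_int m)\<^sup>2)"
  define R where "R = norm (mode m) + 1"
  define q where "q y = quad (mode m + y) (mode m + y)" for y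
  define p where "p y = q y - coef (q y) m *\<^sub>R y" for y
  define K where "K = {y. even_multiples m y} \<inter> cball 0 1"
  \<comment> \<open>\<open>C\<close> bounds the inverse symbol and \<open>R\<close> bounds
    \<open>mode m + y\<close> on the unit ball. Since \<open>p\<close> has Lipschitz constant
    \<open>15 * R\<^sup>2\<close> there, this \<open>\<epsilon>\<close> gives the contraction factor
    1/2.\<close>
  define \<epsilon> where "\<epsilon> = 1 / (30 * C * R\<^sup>2)"
  have "C > 0"
    unfolding C_def by (intro mult_pos_pos add_pos_nonneg) auto
  have "R \<ge> 1"
    by (simp add: R_def)
  then have R2: "R \<le> R\<^sup>2" "1 \<le> R\<^sup>2"
    using mult_mono[of 1 R 1 R] mult_mono[of 1 R R R] by (simp_all add: power2_eq_square)
  have "\<epsilon> > 0"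
    using \<open>C > 0\<close> \<open>R \<ge> 1\<close> by (simp add: \<epsilon>_def)
  have shifted: "norm (mode m + y) \<le> R" if "norm y \<le> 1" for y
    using that norm_triangle_ineq[of "mode m" y] by (simp add: R_def)
  have q_le: "norm (q y) \<le> 3 * R\<^sup>2" if "norm y \<le> 1" for y
  proof -
    have "norm (q y) \<le> 3 * (norm (mode m + y) * norm (mode m + y))"
      unfolding q_def by (rule norm_quad_le)
    also have "\<dots> \<le> 3 * (R * R)"
      using shifted[OF that] \<open>R \<ge> 1\<close> by (intro mult_left_mono mult_mono) auto
    finally show ?thesis
      by (simp add: power2_eq_square)
  qed
  have q_diff: "norm (q y - q z) \<le> 6 * R * norm (y - z)" if "norm y \<le> 1" "norm z \<le> 1" for y z
  proof -
    \<comment> \<open>Telescopes through the mixed term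
      \<open>quad (mode m + y) (mode m + z)\<close>.\<close>
    have "q y - q z = quad (mode m + y) (y - z) + quad (y - z) (mode m + z)"
      unfolding q_def by (simp add: quad.add_left quad.add_right quad.diff_left quad.diff_right)
    also have "norm \<dots> \<le> 3 * (norm (mode m + y) * norm (y - z)) + 3 * (norm (y - z) * norm (mode m + z))"
      by (intro norm_triangle_le add_mono norm_quad_le)
    also have "\<dots> \<le> 3 * (R * norm (y - z)) + 3 * (norm (y - z) * R)"
      using shifted[OF that(1)] shifted[OF that(2)] \<open>R \<ge> 1\<close>
      by (intro add_mono mult_left_mono mult_mono) auto
    finally show ?thesis
      by (simp add: algebra_simps)
  qed
  have p_le: "norm (p y) \<le> 6 * R\<^sup>2" if "norm y \<le> 1" for y
  proof -
    have "norm (p y) \<le> norm (q y) + \<bar>coef (q y) m\<bar> * norm y"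
      unfolding p_def using norm_triangle_ineq4[of "q y" "coef (q y) m *\<^sub>R y"] by simp
    also have "\<dots> \<le> 3 * R\<^sup>2 + (3 * R\<^sup>2) * 1"
      using that q_le[OF that] order.trans[OF abs_coef_le q_le[OF that]]
      by (intro add_mono mult_mono) auto
    finally show ?thesis
      by simp
  qed
  have p_diff: "norm (p y - p z) \<le> 15 * R\<^sup>2 * norm (y - z)" if "norm y \<le> 1" "norm z \<le> 1" for y z
  proof -
    have d: "norm (q y - q z) \<le> 6 * R\<^sup>2 * norm (y - z)"
      by (rule order.trans[OF q_diff[OF that]]) (simp add: R2 mult_right_mono)
    have "p y - p z = (q y - q z) - (coef (q y) m *\<^sub>R (y - z) + coef (q y - q z) m *\<^sub>R z)"
      by (simp add: p_def algebra_simps)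
    also have "norm \<dots> \<le> norm (q y - q z) + (\<bar>coef (q y) m\<bar> * norm (y - z) + \<bar>coef (q y - q z) m\<bar> * norm z)"
      by (intro order.trans[OF norm_triangle_ineq4] add_mono order_refl order.trans[OF norm_triangle_ineq])
        (simp_all del: coef_simps)
    \<comment> \<open>The constant 15 is 6 + 3 + 6, one summand for each factor that varies.\<close>
    also have "\<dots> \<le> 6 * R\<^sup>2 * norm (y - z) + (3 * R\<^sup>2 * norm (y - z) + (6 * R\<^sup>2 * norm (y - z)) * 1)"
      by (intro add_mono mult_mono d order.trans[OF abs_coef_le d] order.trans[OF abs_coef_le q_le] that) auto
    finally show ?thesis
      by (simp add: mult_ac)
  qed
  have map_eq: "bifurcation_map m s y = s *\<^sub>R diag (inverse_symbol m) (p y)" for s y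
    by (simp add: bifurcation_map_def p_def q_def)
  have diag_le: "norm (diag (inverse_symbol m) a) \<le> C * norm a" for a
    unfolding C_def by (rule norm_diag_le[OF abs_inverse_symbol_le])
  have small: "s * (15 * C * R\<^sup>2) \<le> 1 / 2" if "s \<in> {0<..<\<epsilon>}" for s
  proof -
    have "s * (15 * C * R\<^sup>2) \<le> \<epsilon> * (15 * C * R\<^sup>2)"
      using that \<open>C > 0\<close> by (intro mult_right_mono) auto
    also have "\<dots> = 1 / 2"
      using \<open>C > 0\<close> \<open>R \<ge> 1\<close> by (simp add: \<epsilon>_def)
    finally show ?thesis .
  qed
  have contraction: "norm (bifurcation_map m s y - bifurcation_map m s z) \<le> 1 / 2 * norm (y - z)"
    if "s \<in> {0<..<\<epsilon>}" "y \<in> K" "z \<in> K" for s y z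
  proof -
    have "norm (bifurcation_map m s y - bifurcation_map m s z) = s * norm (diag (inverse_symbol m) (p y - p z))"
      using that by (simp add: map_eq diag_simps flip: scaleR_diff_right)
    also have "\<dots> \<le> s * (C * (15 * R\<^sup>2 * norm (y - z)))"
      using that \<open>C > 0\<close> by (intro mult_left_mono order.trans[OF diag_le] p_diff) (auto simp: K_def)
    also have "\<dots> = s * (15 * C * R\<^sup>2) * norm (y - z)"
      by simp
    also have "\<dots> \<le> 1 / 2 * norm (y - z)"
      by (intro mult_right_mono small that) auto
    finally show ?thesis .
  qed
  have "\<exists>y\<in>K. bifurcation_map m s y = y" if s: "s \<in> {0<..<\<epsilon>}" for s
  proof -
    have "\<exists>!y. y \<in> K \<and> bifurcation_map m s y = y"
    proof (rule Banach_fix[of K "1 / 2"])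
      show "complete K"
        unfolding K_def by (intro complete_eq_closed[THEN iffD2] closed_Int closed_even_multiples closed_cball)
      have "0 \<in> K"
        by (simp add: K_def even_multiples_def)
      then show "K \<noteq> {}"
        by blast
      show "bifurcation_map m s ` K \<subseteq> K"
      proof (intro image_subsetI)
        fix y assume y: "y \<in> K"
        have "norm (bifurcation_map m s y) = s * norm (diag (inverse_symbol m) (p y))"
          using s by (simp add: map_eq)
        also have "\<dots> \<le> s * (C * (6 * R\<^sup>2))"
          using s y \<open>C > 0\<close> by (intro mult_left_mono order.trans[OF diag_le] p_le) (auto simp: K_def)
        \<comment> \<open>The smallness chosen for the contraction also keeps the image inside the
          unit ball.\<close>
        also have "\<dots> \<le> s * (15 * C * R\<^sup>2)"
          using s \<open>C > 0\<close> by (intro mult_left_mono) auto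
        finally show "bifurcation_map m s y \<in> K"
          using small[OF s] y even_multiples_bifurcation_map by (simp add: K_def)
      qed
    qed (use contraction[OF s] in \<open>auto simp: dist_norm\<close>)
    then show ?thesis
      by blast
  qed
  then obtain y where y: "\<And>s. s \<in> {0<..<\<epsilon>} \<Longrightarrow> y s \<in> K"
    "\<And>s. s \<in> {0<..<\<epsilon>} \<Longrightarrow> bifurcation_map m s (y s) = y s"
    by metis
  \<comment> \<open>Changing the parameter at a fixed sequence costs
    \<open>6 * C * R\<^sup>2 * \<bar>s - t\<bar>\<close>; absorbing the contracted half of
    \<open>norm (y s - y t)\<close> doubles it.\<close>
  have lipschitz: "norm (y s - y t) \<le> 12 * C * R\<^sup>2 * \<bar>s - t\<bar>" if "s \<in> {0<..<\<epsilon>}" "t \<in> {0<..<\<epsilon>}" for s t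
  proof -
    have "norm (bifurcation_map m s (y t) - bifurcation_map m t (y t)) =
        \<bar>s - t\<bar> * norm (diag (inverse_symbol m) (p (y t)))"
      by (simp add: map_eq flip: scaleR_diff_left)
    also have "\<dots> \<le> \<bar>s - t\<bar> * (C * (6 * R\<^sup>2))"
      using y(1)[OF that(2)] \<open>C > 0\<close>
      by (intro mult_left_mono order.trans[OF diag_le] p_le) (auto simp: K_def)
    finally have "norm (bifurcation_map m s (y t) - bifurcation_map m t (y t)) \<le> \<bar>s - t\<bar> * (C * (6 * R\<^sup>2))" .
    moreover have "norm (y s - y t) \<le> norm (bifurcation_map m s (y s) - bifurcation_map m s (y t)) +
        norm (bifurcation_map m s (y t) - bifurcation_map m t (y t))"
      using norm_triangle_ineq[of "y s - bifurcation_map m s (y t)" "bifurcation_map m s (y t) - y t"]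
      by (simp add: y(2)[OF that(1)] y(2)[OF that(2)])
    ultimately show ?thesis
      using contraction[OF that(1) y(1)[OF that(1)] y(1)[OF that(2)]] by (simp add: mult_ac)
  qed
  have "continuous_on {0<..<\<epsilon>} y"
  proof (rule lipschitz_on_continuous_on[of "12 * C * R\<^sup>2"], rule lipschitz_onI)
    show "dist (y s) (y t) \<le> 12 * C * R\<^sup>2 * dist s t" if "s \<in> {0<..<\<epsilon>}" "t \<in> {0<..<\<epsilon>}" for s t
      using lipschitz[OF that] by (simp add: dist_norm)
  qed (use \<open>C > 0\<close> in simp)
  with \<open>\<epsilon> > 0\<close> y show ?thesis
    by (intro that) (auto simp: K_def)
qed

section \<open>From Fourier coefficients to traveling waves\<close>

lemma deriv_translate:
  assumes "(f has_real_derivative d) (at (x + t))"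
  shows "((\<lambda>x. f (x + t)) has_real_derivative d) (at x)"
  using assms by (simp add: DERIV_shift)

lemma fourier_multiplier_translate:
  assumes f: "wiener_rep f a" and \<mu>: "real_symbol \<mu>"
  shows "fourier_multiplier \<mu> (\<lambda>x. f (x + t)) = (\<lambda>x. fourier_multiplier \<mu> f (x + t))"
proof (rule wiener_rep_unique)
  show "wiener_rep (fourier_multiplier \<mu> (\<lambda>x. f (x + t))) (\<lambda>n. \<mu> n * (a n * cis (of_int n * t)))"
    by (intro wiener_rep_fourier_multiplier wiener_rep_translate f \<mu>)
  show "wiener_rep (\<lambda>x. fourier_multiplier \<mu> f (x + t)) (\<lambda>n. \<mu> n * (a n * cis (of_int n * t)))"
    using wiener_rep_translate[OF wiener_rep_fourier_multiplier[OF f \<mu>], of t] by (simp add: mult.assoc)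
qed

text \<open>The inverse of the identity minus the second derivative. \<open>L_op\<close> is the
  identity minus this operator, and \<open>N_op\<close> is its derivative.\<close>

definition A_op :: "(real \<Rightarrow> real) \<Rightarrow> real \<Rightarrow> real" where
  "A_op = fourier_multiplier (\<lambda>n. of_real (helmholtz_symbol n))"

lemma L_symbol: "(of_int n)\<^sup>2 / (1 + (of_int n)\<^sup>2) = complex_of_real (1 - helmholtz_symbol n)"
proof -
  have "1 - helmholtz_symbol n = (of_int n)\<^sup>2 / (1 + (of_int n)\<^sup>2)"
    using one_plus_square_pos[of n] by (simp add: field_simps)
  then show ?thesis
    by (simp only:) simp
qed

lemma N_symbol: "\<i> * of_int n / (1 + (of_int n)\<^sup>2) = \<i> * complex_of_real (of_int n * helmholtz_symbol n)"
  by simp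

lemma real_symbol_A: "real_symbol (\<lambda>n. of_real (helmholtz_symbol n))"
  using abs_helmholtz_symbol_le unfolding real_symbol_def norm_of_real by simp

lemma real_symbol_L: "real_symbol (\<lambda>n. (of_int n)\<^sup>2 / (1 + (of_int n)\<^sup>2))"
proof -
  have "\<bar>1 - helmholtz_symbol n\<bar> \<le> 1" for n
  proof -
    have "0 < helmholtz_symbol n"
      using one_plus_square_pos[of n] by simp
    then show ?thesis
      using abs_helmholtz_symbol_le[of n] by linarith
  qed
  then show ?thesis
    unfolding real_symbol_def L_symbol norm_of_real by simp
qed

lemma real_symbol_N: "real_symbol (\<lambda>n. \<i> * of_int n / (1 + (of_int n)\<^sup>2))"
  using abs_helmholtz_derivative_symbol_le
  unfolding real_symbol_def N_symbol norm_mult norm_of_real by simp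

lemma wiener_rep_A_op:
  "wiener_rep f a \<Longrightarrow> wiener_rep (A_op f) (\<lambda>n. of_real (helmholtz_symbol n) * a n)"
  unfolding A_op_def by (rule wiener_rep_fourier_multiplier[OF _ real_symbol_A])

lemma wiener_rep_N_op:
  assumes "wiener_rep f a"
  shows "wiener_rep (N_op f) (\<lambda>n. \<i> * of_int n * (of_real (helmholtz_symbol n) * a n))"
  using wiener_rep_fourier_multiplier[OF assms real_symbol_N, folded N_op_def]
  by (simp add: mult.assoc)

lemma wiener_rep_L_op:
  assumes "wiener_rep f a"
  shows "wiener_rep (L_op f) (\<lambda>n. a n - of_real (helmholtz_symbol n) * a n)"
  using wiener_rep_fourier_multiplier[OF assms real_symbol_L, folded L_op_def]
  unfolding L_symbol by (simp add: left_diff_distrib)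

lemma L_op_eq:
  assumes "wiener_rep f a"
  shows "L_op f x = f x - A_op f x"
  using wiener_rep_unique[OF wiener_rep_L_op[OF assms] wiener_rep_diff[OF assms wiener_rep_A_op[OF assms]]]
  by (simp add: fun_eq_iff)

lemma A_op_has_derivative:
  assumes "wiener_rep f a"
  shows "(A_op f has_real_derivative N_op f x) (at x)"
  by (rule wiener_rep_derivative[OF wiener_rep_A_op[OF assms] wiener_rep_N_op[OF assms]])

text \<open>With \<open>u = A_op f\<close> this is \<open>u'' = u - f\<close>, the equation that
  \<open>u\<close> solves.\<close>

lemma N_op_has_derivative:
  assumes "wiener_rep f a"
  shows "(N_op f has_real_derivative A_op f x - f x) (at x)"
proof (rule wiener_rep_derivative[OF wiener_rep_N_op[OF assms]])
  have "\<i> * of_int n * (\<i> * of_int n * (complex_of_real (helmholtz_symbol n) * a n)) =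
      complex_of_real (helmholtz_symbol n) * a n - a n" for n
  proof -
    have "- ((of_int n)\<^sup>2 * complex_of_real (helmholtz_symbol n)) = complex_of_real (helmholtz_symbol n) - 1"
      using L_symbol[of n] by simp
    then have "complex_of_real (helmholtz_symbol n) * a n - a n =
        - ((of_int n)\<^sup>2 * complex_of_real (helmholtz_symbol n)) * a n"
      by (simp only: left_diff_distrib mult_1_left)
    then show ?thesis
      by (simp add: power2_eq_square mult_ac)
  qed
  then show "wiener_rep (\<lambda>x. A_op f x - f x)
      (\<lambda>n. \<i> * of_int n * (\<i> * of_int n * (complex_of_real (helmholtz_symbol n) * a n)))"
    by (simp only: wiener_rep_diff[OF wiener_rep_A_op[OF assms] assms])
qed

text \<open>Multipliers commute with differentiation, so the derivative of \<open>A_op f\<close> is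
  \<open>A_op\<close> of the derivative of \<open>f\<close>.\<close>

lemma N_op_eq_A_op_derivative:
  assumes f: "wiener_rep f a" and g: "wiener_rep g b"
    and "\<And>x. (f has_real_derivative g x) (at x)"
  shows "N_op f = A_op g"
proof -
  have "b n = \<i> * of_int n * a n" for n
    by (rule wiener_rep_of_derivative[OF assms])
  then have "wiener_rep (A_op g) (\<lambda>n. \<i> * of_int n * (of_real (helmholtz_symbol n) * a n))"
    using wiener_rep_A_op[OF g] by (simp add: mult.left_commute)
  with wiener_rep_N_op[OF f] show ?thesis
    by (rule wiener_rep_unique)
qed

lemma A_op_cmult:
  assumes "wiener_rep f a"
  shows "A_op (\<lambda>x. c * f x) x = c * A_op f x"
proof -
  have "wiener_rep (A_op (\<lambda>x. c * f x)) (\<lambda>n. of_real c * (of_real (helmholtz_symbol n) * a n))"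
    using wiener_rep_A_op[OF wiener_rep_cmult[OF assms, of c]] by (simp add: mult.left_commute)
  from wiener_rep_unique[OF this wiener_rep_cmult[OF wiener_rep_A_op[OF assms]]] show ?thesis
    by (simp add: fun_eq_iff)
qed

text \<open>With \<open>u = A_op \<phi>\<close>, so that \<open>\<phi> = u - u''\<close>, the commutator is \<open>u u' - A_op (u' \<phi>)\<close>, which is the
  derivative of \<open>u\<^sup>2 / 2 - A_op (u\<^sup>2 - u'\<^sup>2) / 2\<close>: the profile equation is a total derivative.\<close>

lemma integrated_profile_equation:
  assumes \<phi>: "wiener_rep \<phi> a" and deriv: "\<And>x. (\<phi> has_real_derivative \<phi>' x) (at x)"
    and eq: "\<And>x. 3 / 2 * (\<phi> x * \<phi> x) - A_op \<phi> x * A_op \<phi> x / 2 +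
      A_op (\<lambda>x. A_op \<phi> x * A_op \<phi> x - N_op \<phi> x * N_op \<phi> x) x / 2 - A_op \<phi> x - (1 + 2 * c) * \<phi> x = 0"
  shows "equation_rhs \<phi> x = - c * \<phi>' x"
proof -
  define u w g where "u = A_op \<phi>" and "w = N_op \<phi>" and "g = (\<lambda>x. u x * u x - w x * w x)"
  have u: "wiener_rep u (\<lambda>n. of_real (helmholtz_symbol n) * a n)"
    unfolding u_def by (rule wiener_rep_A_op[OF \<phi>])
  have w: "wiener_rep w (\<lambda>n. \<i> * of_int n * (of_real (helmholtz_symbol n) * a n))"
    unfolding w_def by (rule wiener_rep_N_op[OF \<phi>])
  note w\<phi> = wiener_rep_mult[OF w \<phi>]
  note g = wiener_rep_diff[OF wiener_rep_mult[OF u u] wiener_rep_mult[OF w w], folded g_def]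
  have u': "(u has_real_derivative w x) (at x)" for x
    unfolding u_def w_def by (rule A_op_has_derivative[OF \<phi>])
  have w': "(w has_real_derivative u x - \<phi> x) (at x)" for x
    unfolding u_def w_def by (rule N_op_has_derivative[OF \<phi>])
  \<comment> \<open>The derivative is \<open>2 u w - 2 w (u - \<phi>)\<close>, in which the products
    \<open>u w\<close> cancel.\<close>
  have "(g has_real_derivative 2 * (w x * \<phi> x)) (at x)" for x
    unfolding g_def by (auto intro!: derivative_eq_intros u' w' simp: algebra_simps)
  from N_op_eq_A_op_derivative[OF g wiener_rep_cmult[OF w\<phi>] this]
  have "N_op g x = 2 * A_op (\<lambda>x. w x * \<phi> x) x" for x
    by (simp add: A_op_cmult[OF w\<phi>])
  with A_op_has_derivative[OF g]
  have v': "(A_op g has_real_derivative 2 * A_op (\<lambda>x. w x * \<phi> x) x) (at x)" for x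
    by simp
  have "((\<lambda>x. 3 / 2 * (\<phi> x * \<phi> x) - u x * u x / 2 + A_op g x / 2 - u x - (1 + 2 * c) * \<phi> x)
      has_real_derivative
      3 * \<phi> x * \<phi>' x - w x * u x + A_op (\<lambda>x. w x * \<phi> x) x - w x - (1 + 2 * c) * \<phi>' x) (at x)"
    by (auto intro!: derivative_eq_intros u' v' deriv simp: algebra_simps)
  moreover have "3 / 2 * (\<phi> x * \<phi> x) - u x * u x / 2 + A_op g x / 2 - u x - (1 + 2 * c) * \<phi> x = 0" for x
    using eq[of x] by (simp add: u_def w_def g_def)
  ultimately have "3 * \<phi> x * \<phi>' x - w x * u x + A_op (\<lambda>x. w x * \<phi> x) x - w x - (1 + 2 * c) * \<phi>' x = 0"
    using DERIV_unique[OF _ DERIV_const] by (simp only:)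
  moreover have "commutator L_op w \<phi> x = w x * u x - A_op (\<lambda>x. w x * \<phi> x) x"
    unfolding commutator_def L_op_eq[OF w\<phi>] L_op_eq[OF \<phi>] u_def by (simp add: right_diff_distrib)
  moreover have "deriv \<phi> x = \<phi>' x"
    by (rule DERIV_imp_deriv[OF deriv])
  ultimately show ?thesis
    unfolding equation_rhs_def w_def[symmetric] by (simp add: algebra_simps)
qed

text \<open>All operators involved are Fourier multipliers or pointwise, hence commute with
  translations. This carries the profile equation to every time.\<close>

lemma equation_rhs_translate:
  assumes \<phi>: "wiener_rep \<phi> a" and deriv: "\<And>x. (\<phi> has_real_derivative \<phi>' x) (at x)"
  shows "equation_rhs (\<lambda>x. \<phi> (x + t)) x = equation_rhs \<phi> (x + t)"
proof -
  have N: "N_op (\<lambda>x. \<phi> (x + t)) = (\<lambda>x. N_op \<phi> (x + t))"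
    unfolding N_op_def by (rule fourier_multiplier_translate[OF \<phi> real_symbol_N])
  have L\<phi>: "L_op (\<lambda>x. \<phi> (x + t)) = (\<lambda>x. L_op \<phi> (x + t))"
    unfolding L_op_def by (rule fourier_multiplier_translate[OF \<phi> real_symbol_L])
  have L: "L_op (\<lambda>x. N_op \<phi> (x + t) * \<phi> (x + t)) = (\<lambda>x. L_op (\<lambda>x. N_op \<phi> x * \<phi> x) (x + t))"
    unfolding L_op_def
    by (rule fourier_multiplier_translate[OF wiener_rep_mult[OF wiener_rep_N_op[OF \<phi>] \<phi>] real_symbol_L])
  have "deriv (\<lambda>x. \<phi> (x + t)) x = deriv \<phi> (x + t)"
    using DERIV_imp_deriv[OF deriv] DERIV_imp_deriv[OF deriv_translate[where f = \<phi>, OF deriv]] by simp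
  then show ?thesis
    by (simp add: equation_rhs_def commutator_def N L\<phi> L)
qed

lemma traveling_wave_of_profile_equation:
  assumes \<phi>: "wiener_rep \<phi> a" and deriv: "\<And>x. (\<phi> has_real_derivative \<phi>' x) (at x)"
    and eq: "\<And>x. equation_rhs \<phi> x = - c * \<phi>' x"
  shows "traveling_wave_solution c \<phi>"
  unfolding traveling_wave_solution_def solves_equation_def
proof (intro conjI allI)
  fix x t
  show "two_pi_periodic (\<lambda>x. \<phi> (x - c * t))"
    using wiener_rep_two_pi_periodic[OF wiener_rep_translate[OF \<phi>, of "- (c * t)"]] by simp
  show "(\<lambda>y. \<phi> (y - c * t)) differentiable at x"
    unfolding real_differentiable_def diff_conv_add_uminus
    by (rule exI, rule deriv_translate[where f = \<phi>, OF deriv])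
  have "((\<lambda>t. \<phi> (x - c * t)) has_real_derivative \<phi>' (x - c * t) * - c) (at t)"
    by (rule DERIV_chain2[OF deriv]) (auto intro!: derivative_eq_intros)
  moreover have "equation_rhs (\<lambda>y. \<phi> (y - c * t)) x = \<phi>' (x - c * t) * - c"
    using equation_rhs_translate[OF \<phi> deriv, of "- (c * t)" x] eq by simp
  ultimately show "((\<lambda>t. \<phi> (x - c * t)) has_real_derivative equation_rhs (\<lambda>y. \<phi> (y - c * t)) x) (at t)"
    by simp
qed

text \<open>At distance at most 1 the mean value theorem bounds the increment of \<open>f'\<close>,
  because there \<open>\<bar>x - y\<bar> \<le> \<bar>x - y\<bar> powr \<alpha>\<close>; at larger
  distances the bound on \<open>f'\<close> itself does. The three suprema contribute
  \<open>N + N + 2 * N\<close>.\<close>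

lemma C1_holder_of_bounded_derivatives:
  assumes f: "\<And>x. (f has_real_derivative f' x) (at x)" and f': "\<And>x. (f' has_real_derivative f'' x) (at x)"
    and bounds: "\<And>x. \<bar>f x\<bar> \<le> N" "\<And>x. \<bar>f' x\<bar> \<le> N" "\<And>x. \<bar>f'' x\<bar> \<le> N"
    and per: "two_pi_periodic f" and \<alpha>: "0 < \<alpha>" "\<alpha> < 1"
  shows "f \<in> C1_holder \<alpha>" and "0 \<le> C1_holder_norm \<alpha> f" and "C1_holder_norm \<alpha> f \<le> 4 * N"
proof -
  have deriv: "deriv f x = f' x" for x
    by (rule DERIV_imp_deriv[OF f])
  have "0 \<le> N"
    using bounds(1)[of 0] by linarith
  have holder: "\<bar>f' x - f' y\<bar> \<le> 2 * N * \<bar>x - y\<bar> powr \<alpha>" for x y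
  proof (cases "\<bar>x - y\<bar> \<le> 1")
    case True
    have "\<bar>f' x - f' y\<bar> \<le> N * \<bar>x - y\<bar>"
      using field_differentiable_bound[of UNIV f' f'' N x y] f' bounds(3) by auto
    also have "\<bar>x - y\<bar> \<le> \<bar>x - y\<bar> powr \<alpha>"
      using powr_mono'[of \<alpha> 1 "\<bar>x - y\<bar>"] True \<alpha> by simp
    also have "N * \<bar>x - y\<bar> powr \<alpha> \<le> 2 * N * \<bar>x - y\<bar> powr \<alpha>"
      using \<open>0 \<le> N\<close> by (intro mult_right_mono) auto
    finally show ?thesis
      using \<open>0 \<le> N\<close> by (simp add: mult_left_mono)
  next
    case False
    have "\<bar>f' x - f' y\<bar> \<le> 2 * N * 1"
      using bounds(2)[of x] bounds(2)[of y] by linarith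
    also have "\<dots> \<le> 2 * N * \<bar>x - y\<bar> powr \<alpha>"
      using False \<alpha> \<open>0 \<le> N\<close> by (intro mult_left_mono ge_one_powr_ge_zero) auto
    finally show ?thesis .
  qed
  show "f \<in> C1_holder \<alpha>"
    using per f holder by (auto simp: C1_holder_def deriv real_differentiable_def)
  have quotient: "\<bar>f' x - f' y\<bar> / \<bar>x - y\<bar> powr \<alpha> \<le> 2 * N" if "x \<noteq> y" for x y
    using holder[of x y] that by (simp add: pos_divide_le_eq)
  have S: "{(x, y). x \<noteq> y} \<noteq> ({} :: (real \<times> real) set)"
    by (auto intro: exI[of _ 0] exI[of _ 1])
  have le: "(SUP x. \<bar>f x\<bar>) \<le> N" "(SUP x. \<bar>f' x\<bar>) \<le> N"
    "(SUP (x, y) \<in> {(x, y). x \<noteq> y}. \<bar>f' x - f' y\<bar> / \<bar>x - y\<bar> powr \<alpha>) \<le> 2 * N"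
    using S by (auto intro!: cSUP_least bounds quotient)
  then show "C1_holder_norm \<alpha> f \<le> 4 * N"
    by (simp add: C1_holder_norm_def deriv)
  have "0 \<le> (SUP x. \<bar>f x\<bar>)"
    by (rule cSUP_upper2[of _ _ 0]) (auto intro!: bdd_aboveI2 bounds)
  moreover have "0 \<le> (SUP x. \<bar>f' x\<bar>)"
    by (rule cSUP_upper2[of _ _ 0]) (auto intro!: bdd_aboveI2 bounds)
  moreover have "0 \<le> (SUP (x, y) \<in> {(x, y). x \<noteq> y}. \<bar>f' x - f' y\<bar> / \<bar>x - y\<bar> powr \<alpha>)"
    by (rule cSUP_upper2[of _ _ "(0, 1)"]) (auto intro!: bdd_aboveI2 quotient)
  ultimately show "0 \<le> C1_holder_norm \<alpha> f"
    by (simp add: C1_holder_norm_def deriv)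
qed

section \<open>Waves built from coefficient sequences\<close>

abbreviation cseq :: "wseq \<Rightarrow> int \<Rightarrow> complex" where
  "cseq a n \<equiv> complex_of_real (coef a n)"

definition wave :: "wseq \<Rightarrow> real \<Rightarrow> real" where
  "wave a x = Re (fseries (cseq a) x)"

text \<open>Treats the wave and its first two derivatives at once: \<open>r n\<close> will be
  \<open>1\<close>, \<open>\<i> * n\<close> and \<open>- n\<^sup>2\<close>, all dominated by the
  weight.\<close>

lemma
  assumes r: "\<And>n. norm (r n) \<le> weight n" and sym: "\<And>n. r (- n) = cnj (r n)"
    and a: "even_multiples m a"
  shows wiener_rep_weighted: "wiener_rep (\<lambda>x. Re (fseries (\<lambda>n. r n * cseq a n) x)) (\<lambda>n. r n * cseq a n)"
    and abs_Re_fseries_le: "\<bar>Re (fseries (\<lambda>n. r n * cseq a n) x)\<bar> \<le> norm a"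
proof -
  have le: "norm (r n * cseq a n) \<le> weight n * \<bar>coef a n\<bar>" for n
    using r[of n] by (simp add: norm_mult mult_right_mono)
  then have s: "(\<lambda>n. r n * cseq a n) abs_summable_on UNIV"
    by (rule Infinite_Sum.abs_summable_on_comparison_test'[OF coef_weighted_summable])
  then show "wiener_rep (\<lambda>x. Re (fseries (\<lambda>n. r n * cseq a n) x)) (\<lambda>n. r n * cseq a n)"
    by (rule wiener_rep_Re_fseries) (use a in \<open>simp add: sym even_multiples_def\<close>)
  have "\<bar>Re (fseries (\<lambda>n. r n * cseq a n) x)\<bar> \<le> (\<Sum>\<^sub>\<infinity>n. norm (r n * cseq a n))"
    by (rule order.trans[OF abs_Re_le_cmod norm_fseries_le[OF s]])
  also have "\<dots> \<le> norm a"
    unfolding norm_wseq_def by (rule infsum_mono[OF s coef_weighted_summable le])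
  finally show "\<bar>Re (fseries (\<lambda>n. r n * cseq a n) x)\<bar> \<le> norm a" .
qed

text \<open>The weight controls two derivatives, which makes the passage from sequences to Hoelder
  functions bounded, with constant 4.\<close>

lemma
  assumes a: "even_multiples m a"
  shows wiener_rep_wave: "wiener_rep (wave a) (cseq a)"
    and wave_differentiable: "\<exists>f'. \<forall>x. (wave a has_real_derivative f' x) (at x)"
    and wave_C1_holder: "0 < \<alpha> \<Longrightarrow> \<alpha> < 1 \<Longrightarrow> wave a \<in> C1_holder \<alpha>"
    and C1_holder_norm_wave_nonneg: "0 < \<alpha> \<Longrightarrow> \<alpha> < 1 \<Longrightarrow> 0 \<le> C1_holder_norm \<alpha> (wave a)"
    and C1_holder_norm_wave_le: "0 < \<alpha> \<Longrightarrow> \<alpha> < 1 \<Longrightarrow> C1_holder_norm \<alpha> (wave a) \<le> 4 * norm a"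
proof -
  have r0: "norm (1::complex) \<le> weight n" for n
    using weight_ge_1[of n] by simp
  have r1: "norm (\<i> * of_int n) \<le> weight n" for n
    by (simp add: norm_mult power2_sum)
  have r2: "norm (- (of_int n)\<^sup>2 :: complex) \<le> weight n" for n
    by (simp add: norm_power power2_sum)
  define f' where "f' x = Re (fseries (\<lambda>n. \<i> * of_int n * cseq a n) x)" for x
  define f'' where "f'' x = Re (fseries (\<lambda>n. - (of_int n)\<^sup>2 * cseq a n) x)" for x
  have eq: "wave a = (\<lambda>x. Re (fseries (\<lambda>n. 1 * cseq a n) x))"
    by (simp add: wave_def fun_eq_iff)
  have rep0: "wiener_rep (wave a) (\<lambda>n. 1 * cseq a n)"
    unfolding eq by (rule wiener_rep_weighted[OF r0 _ a]) simp
  then show rep: "wiener_rep (wave a) (cseq a)"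
    by simp
  have rep1: "wiener_rep f' (\<lambda>n. \<i> * of_int n * cseq a n)"
    unfolding f'_def by (rule wiener_rep_weighted[OF r1 _ a]) simp
  have rep2: "wiener_rep f'' (\<lambda>n. - (of_int n)\<^sup>2 * cseq a n)"
    unfolding f''_def by (rule wiener_rep_weighted[OF r2 _ a]) simp
  have "(\<lambda>n. - (of_int n)\<^sup>2 * cseq a n) = (\<lambda>n. \<i> * of_int n * (\<i> * of_int n * cseq a n))"
    by (simp add: fun_eq_iff power2_eq_square mult_ac)
  then have rep2': "wiener_rep f'' (\<lambda>n. \<i> * of_int n * (\<i> * of_int n * cseq a n))"
    using rep2 by simp
  note d0 = wiener_rep_derivative[OF rep rep1] and d1 = wiener_rep_derivative[OF rep1 rep2']
  show "\<exists>f'. \<forall>x. (wave a has_real_derivative f' x) (at x)"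
    using d0 by blast
  have b: "\<bar>wave a x\<bar> \<le> norm a" "\<bar>f' x\<bar> \<le> norm a" "\<bar>f'' x\<bar> \<le> norm a" for x
    unfolding eq f'_def f''_def
    by (rule abs_Re_fseries_le[OF r0 _ a] abs_Re_fseries_le[OF r1 _ a] abs_Re_fseries_le[OF r2 _ a]; simp)+
  assume \<alpha>: "0 < \<alpha>" "\<alpha> < 1"
  note bounds = C1_holder_of_bounded_derivatives[OF d0 d1 b wiener_rep_two_pi_periodic[OF rep] \<alpha>]
  show "wave a \<in> C1_holder \<alpha>" "0 \<le> C1_holder_norm \<alpha> (wave a)" "C1_holder_norm \<alpha> (wave a) \<le> 4 * norm a"
    by (rule bounds)+
qed

lemma wave_diff:
  assumes "even_multiples m a" "even_multiples m b"
  shows "wave (a - b) = (\<lambda>x. wave a x - wave b x)"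
proof (rule wiener_rep_unique)
  show "wiener_rep (wave (a - b)) (\<lambda>n. cseq a n - cseq b n)"
    using wiener_rep_wave[OF even_multiples_diff[OF assms]] by simp
  show "wiener_rep (\<lambda>x. wave a x - wave b x) (\<lambda>n. cseq a n - cseq b n)"
    by (rule wiener_rep_diff[OF wiener_rep_wave[OF assms(1)] wiener_rep_wave[OF assms(2)]])
qed

lemma conv_cseq: "conv (cseq a) (cseq b) n = complex_of_real (conv (coef a) (coef b) n)"
  unfolding conv_def of_real_mult[symmetric]
  by (rule infsumI[OF has_sum_of_real[OF has_sum_infsum[OF conv_terms_summable]]])

text \<open>The hypothesis says that both sides of the integrated profile equation have the same
  Fourier coefficients, so they are the same function.\<close>

lemma traveling_wave_solution_wave:
  assumes a: "even_multiples m a" and eq: "\<And>n. coef (quad a a) n = (helmholtz_symbol n + (1 + 2 * c)) * coef a n"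
  shows "traveling_wave_solution c (wave a)"
proof -
  define \<phi> where "\<phi> = wave a"
  have \<phi>: "wiener_rep \<phi> (cseq a)"
    unfolding \<phi>_def by (rule wiener_rep_wave[OF a])
  obtain \<phi>' where deriv: "\<And>x. (\<phi> has_real_derivative \<phi>' x) (at x)"
    using wave_differentiable[OF a] unfolding \<phi>_def by blast
  have u: "wiener_rep (A_op \<phi>) (cseq (smooth a))"
    using wiener_rep_A_op[OF \<phi>] by (simp add: coef_smooth)
  have w: "wiener_rep (N_op \<phi>) (\<lambda>n. \<i> * cseq (smooth_deriv a) n)"
    using wiener_rep_N_op[OF \<phi>] by (simp add: coef_smooth_deriv mult.assoc)
  \<comment> \<open>The square of \<open>\<i>\<close> turns the plus sign in \<open>quad\<close>
    into the minus sign in front of the square of \<open>N_op \<phi>\<close>.\<close>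
  have ww: "conv (\<lambda>n. \<i> * cseq (smooth_deriv a) n) (\<lambda>n. \<i> * cseq (smooth_deriv a) n) n = - complex_of_real (conv (coef (smooth_deriv a)) (coef (smooth_deriv a)) n)" for n
  proof -
    have i: "(\<i> * v) * (\<i> * z) = - (v * z)" for v z
    proof -
      have "(\<i> * v) * (\<i> * z) = (\<i> * \<i>) * (v * z)"
        by (simp only: mult_ac)
      then show ?thesis
        by simp
    qed
    have "conv (\<lambda>n. \<i> * cseq (smooth_deriv a) n) (\<lambda>n. \<i> * cseq (smooth_deriv a) n) n = - conv (cseq (smooth_deriv a)) (cseq (smooth_deriv a)) n"
      unfolding conv_def i infsum_uminus ..
    then show ?thesis
      by (simp only: conv_cseq)
  qed
  note uu = wiener_rep_mult[OF u u] and rep_ww = wiener_rep_mult[OF w w]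
  have lhs: "wiener_rep (\<lambda>x. 3 / 2 * (\<phi> x * \<phi> x) - 1 / 2 * (A_op \<phi> x * A_op \<phi> x) +
      1 / 2 * A_op (\<lambda>x. A_op \<phi> x * A_op \<phi> x - N_op \<phi> x * N_op \<phi> x) x)
     (\<lambda>n. of_real (coef (quad a a) n))"
    by (rule wiener_rep_cong[OF wiener_rep_add[OF wiener_rep_diff[OF
          wiener_rep_cmult[OF wiener_rep_mult[OF \<phi> \<phi>], of "3 / 2"] wiener_rep_cmult[OF uu, of "1 / 2"]]
          wiener_rep_cmult[OF wiener_rep_A_op[OF wiener_rep_diff[OF uu rep_ww]], of "1 / 2"]]])
      (simp_all add: coef_quad conv_cseq ww)
  have rhs: "wiener_rep (\<lambda>x. A_op \<phi> x + (1 + 2 * c) * \<phi> x) (\<lambda>n. of_real (coef (quad a a) n))"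
    by (rule wiener_rep_cong[OF wiener_rep_add[OF u wiener_rep_cmult[OF \<phi>, of "1 + 2 * c"]]])
      (simp_all add: eq coef_smooth distrib_right)
  have "equation_rhs \<phi> x = - c * \<phi>' x" for x
    by (rule integrated_profile_equation[OF \<phi> deriv])
      (use fun_cong[OF wiener_rep_unique[OF lhs rhs]] in \<open>simp add: algebra_simps\<close>)
  then show ?thesis
    unfolding \<phi>_def[symmetric] by (rule traveling_wave_of_profile_equation[OF \<phi> deriv])
qed

lemma m_fold_wave:
  assumes a: "even_multiples (int m) a" and "m \<ge> 1"
  shows "m_fold m (wave a)"
  unfolding m_fold_def
proof (intro allI wiener_rep_periodic[OF wiener_rep_wave[OF a]])
  fix n assume "cseq a n \<noteq> 0"
  then obtain k where "n = int m * k"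
    using a by (auto simp: even_multiples_def)
  then have "of_int n * (2 * pi / real m) = of_int k * (2 * pi)"
    using \<open>m \<ge> 1\<close> by simp
  then show "cis (of_int n * (2 * pi / real m)) = 1"
    by (simp only: cis_2pi_int)
qed

text \<open>Translation multiplies coefficients by numbers of modulus 1, so their moduli distinguish
  waves up to translation.\<close>

lemma wave_coef_translate:
  assumes a: "even_multiples m a" and b: "even_multiples m b" and "\<And>x. wave a x = wave b (x + t)"
  shows "cseq a n = cseq b n * cis (of_int n * t)"
proof -
  have "wave a = (\<lambda>x. wave b (x + t))"
    using assms(3) by auto
  then show ?thesis
    using wiener_rep_fourier_coeff[OF wiener_rep_wave[OF a], of n]
      wiener_rep_fourier_coeff[OF wiener_rep_translate[OF wiener_rep_wave[OF b], of t], of n] by simp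
qed

text \<open>A constant is invariant under the shift by \<open>pi / m\<close>, whereas this shift
  changes the sign of mode \<open>m\<close>.\<close>

lemma wave_not_constant:
  assumes a: "even_multiples (int m) a" and "m \<ge> 1" and "coef a (int m) \<noteq> 0"
  shows "\<not> wave a constant_on UNIV"
proof
  assume "wave a constant_on UNIV"
  then have "wave a x = wave a (x + pi / real m)" for x
    unfolding constant_on_def by (metis UNIV_I)
  from wave_coef_translate[OF a a this, of "int m"] assms(2,3) show False
    by (simp add: complex_eq_iff)
qed

section \<open>Assembly of the curve of m-fold waves\<close>

theorem theorem2:
  fixes \<alpha> :: real and m :: nat
  assumes "0 < \<alpha>" and "\<alpha> < 1" and "m \<ge> 1"
  shows "\<exists>(I :: real set) (c :: real \<Rightarrow> real) (\<phi> :: real \<Rightarrow> real \<Rightarrow> real).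
           is_interval I \<and> interior I \<noteq> {} \<and>
           continuous_curve \<alpha> I c \<phi> \<and>
           (\<forall>s\<in>I. \<forall>t\<in>I. same_wave (c s) (\<phi> s) (c t) (\<phi> t) \<longrightarrow> s = t) \<and>
           (\<forall>s\<in>I. \<phi> s \<in> C1_holder \<alpha> \<and> m_fold m (\<phi> s) \<and> \<not> \<phi> s constant_on UNIV \<and>
                  traveling_wave_solution (c s) (\<phi> s))"
proof -
  define M where "M = int m"
  obtain \<epsilon> y where "\<epsilon> > 0" and y_cont: "continuous_on {0<..<\<epsilon>} y"
    and y_even: "\<And>s. s \<in> {0<..<\<epsilon>} \<Longrightarrow> even_multiples M (y s)"
    and y_fixed: "\<And>s. s \<in> {0<..<\<epsilon>} \<Longrightarrow> bifurcation_map M s (y s) = y s"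
    using bifurcation_curve by metis
  \<comment> \<open>Positive \<open>s\<close> excludes the zero solution and makes \<open>s\<close>
    the modulus of the coefficient at \<open>M\<close>.\<close>
  define I where "I = {0<..<\<epsilon>}"
  define a where "a s = s *\<^sub>R (mode M + y s)" for s
  \<comment> \<open>Solves \<open>1 + 2 * c s = s * \<nu> - helmholtz_symbol M\<close>, where
    \<open>\<nu>\<close> is the coefficient of \<open>quad\<close> at \<open>M\<close>.\<close>
  define c where "c s = (s * coef (quad (mode M + y s) (mode M + y s)) M - helmholtz_symbol M - 1) / 2" for s
  have a_even: "even_multiples M (a s)" if "s \<in> I" for s
    using y_even that by (auto simp: a_def I_def intro!: even_multiples_scaleR even_multiples_add even_multiples_mode)
  have a_mode: "coef (a s) M = s" if "s \<in> I" for s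
    using bifurcation_map_fixed_point(1)[OF y_fixed y_even] that by (simp add: a_def I_def)
  have solves: "traveling_wave_solution (c s) (wave (a s))" if "s \<in> I" for s
  proof (rule traveling_wave_solution_wave[OF a_even[OF that]])
    have "1 + 2 * ((u - v - 1) / 2) = u - v" for u v :: real
      by (simp add: field_simps)
    then have "1 + 2 * c s = s * coef (quad (mode M + y s) (mode M + y s)) M - helmholtz_symbol M"
      by (simp only: c_def)
    moreover have "coef (quad (a s) (a s)) n =
        (helmholtz_symbol n - helmholtz_symbol M + s * coef (quad (mode M + y s) (mode M + y s)) M) * coef (a s) n" for n
      unfolding a_def using bifurcation_map_fixed_point(2)[OF y_fixed y_even] that by (simp add: I_def)
    ultimately show "coef (quad (a s) (a s)) n = (helmholtz_symbol n + (1 + 2 * c s)) * coef (a s) n" for n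
      by (simp only: add_diff_eq diff_add_eq)
  qed
  have "continuous_on I c"
    unfolding c_def I_def
    by (intro continuous_intros quad.continuous_on bounded_linear.continuous_on[OF bounded_linear_coef] y_cont) auto
  have a_cont: "continuous_on I a"
    unfolding a_def I_def by (intro continuous_intros y_cont)
  have "continuous_curve \<alpha> I c (\<lambda>s. wave (a s))"
    unfolding continuous_curve_def
  proof (intro conjI ballI)
    show "wave (a s) \<in> C1_holder \<alpha>" if "s \<in> I" for s
      by (rule wave_C1_holder[OF a_even[OF that] assms(1,2)])
    fix s assume s: "s \<in> I"
    \<comment> \<open>Continuity in the weighted norm dominates continuity in the Hoelder
      norm.\<close>
    have "((\<lambda>t. 4 * norm (a t - a s)) \<longlongrightarrow> 4 * norm (a s - a s)) (at s within I)"
      using a_cont s unfolding continuous_on_def by (intro tendsto_intros) auto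
    then have lim: "((\<lambda>t. 4 * norm (a t - a s)) \<longlongrightarrow> 0) (at s within I)"
      by simp
    have "\<forall>\<^sub>F t in at s within I. t \<in> I"
      by (simp add: eventually_at_filter)
    then have "\<forall>\<^sub>F t in at s within I. norm (C1_holder_norm \<alpha> (\<lambda>x. wave (a t) x - wave (a s) x)) \<le> 4 * norm (a t - a s)"
    proof eventually_elim
      case (elim t)
      note even = even_multiples_diff[OF a_even[OF elim] a_even[OF s]]
      show ?case
        using C1_holder_norm_wave_nonneg[OF even assms(1,2)] C1_holder_norm_wave_le[OF even assms(1,2)]
        by (simp add: wave_diff[OF a_even[OF elim] a_even[OF s]])
    qed
    from this lim show "((\<lambda>t. C1_holder_norm \<alpha> (\<lambda>x. wave (a t) x - wave (a s) x)) \<longlongrightarrow> 0) (at s within I)"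
      by (rule Lim_null_comparison)
  qed fact
  moreover have "s = t" if st: "s \<in> I" "t \<in> I" and same: "same_wave (c s) (wave (a s)) (c t) (wave (a t))" for s t
  proof -
    obtain b where "\<And>x. wave (a s) x = wave (a t) (x + b)"
      using same by (auto simp: same_wave_def)
    from wave_coef_translate[OF a_even[OF st(1)] a_even[OF st(2)] this, of M]
    \<comment> \<open>Taking moduli removes the translation factor; positivity then gives
      \<open>s = t\<close>.\<close>
    have "norm (complex_of_real s) = norm (complex_of_real t * cis (of_int M * b))"
      by (simp only: a_mode st)
    with st show ?thesis
      by (simp add: norm_mult I_def)
  qed
  moreover have "\<not> wave (a s) constant_on UNIV" if "s \<in> I" for s
    using wave_not_constant[OF a_even[OF that, unfolded M_def] assms(3)] a_mode[OF that] that
    by (simp add: M_def I_def)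
  moreover have "m_fold m (wave (a s))" if "s \<in> I" for s
    using m_fold_wave[OF a_even[OF that, unfolded M_def] assms(3)] .
  moreover have "is_interval I" "interior I \<noteq> {}"
    using \<open>\<epsilon> > 0\<close> by (simp_all add: I_def is_interval_oo interior_open)
  ultimately show ?thesis
    using wave_C1_holder[OF a_even assms(1,2)] solves
    by (intro exI[of _ I] exI[of _ c] exI[of _ "\<lambda>s. wave (a s)"]) blast
qed

end
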